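(* Let $(K,v)$ be a valued field, $(\widehat{K},\widehat{v})$ its completion, and $w$ an extension of $v$ to $K(X)$. Fix an extension $\overline{\widehat{v}}$ of $\widehat{v}$ to the algebraic closure $\overline{\widehat{K}}$ of $\widehat{K}$, and put $\overline{v}:=\overline{\widehat{v}}|_{\overline{K}}$. Take two common extensions $\overline{w}$ and $\overline{w}_1$ of $w$ and $\overline{v}$ to $\overline{K}(X)$, and consider the corresponding induced extensions $(\widehat{K}(X)|\widehat{K},\widehat{w})$ and $(\widehat{K}(X)|\widehat{K},\widehat{w}_1)$. Then: (i) $(\widehat{K}(X)|\widehat{K},\widehat{w})$ is valuation algebraic if and only if $(\widehat{K}(X)|\widehat{K},\widehat{w}_1)$ is valuation algebraic; (ii) $(\widehat{K}(X)|\widehat{K},\widehat{w})$ is valuation transcendental if and only if $(\widehat{K}(X)|\widehat{K},\widehat{w}_1)$ is valuation transcendental. When the induced extensions are valuation transcendental, one can choose minimal pairs of definition $(a,\gamma)$ for $\widehat{w}$ over $\widehat{K}$ and $(a_1,\gamma)$ for $\widehat{w}_1$ over $\widehat{K}$ (with the same $\gamma$) such that $a$ and $a_1$ are conjugates over $\widehat{K}$. Further, if $a,a_1\in\overline{K}$, then they are also conjugates over $K$.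
   Context: Valuations are Krull valuations written additively; $vL$ and $Lv$ denote value group and residue field. $(K,v)$ is dense in an extension $(L,v)$ if for every $a\in L$, $\gamma\in vL$ there is $b\in K$ with $v(a-b)>\gamma$; the completion of $(K,v)$ is the maximal extension in which $(K,v)$ is dense. $\overline{K}$ is taken inside $\overline{\widehat{K}}$. An extension $(F(X)|F,v)$ is value transcendental if $\dim_{\mathbb{Q}}\big((vF(X)/vF)\otimes\mathbb{Q}\big)=1$, residue transcendental if $\mathrm{trdeg}[F(X)v:Fv]=1$, valuation transcendental if it is one of these, and valuation algebraic otherwise. For $a\in\overline{F}$ and $\gamma$ in an ordered abelian group containing $v\overline{F}$, $v_{a,\gamma}$ is the valuation on $\overline{F}(X)$ given on polynomials by $v_{a,\gamma}\big(\sum C_i(X-a)^i\big)=\min_i\{vC_i+i\gamma\}$. Given a valuation $v$ on $\overline{F}(X)$ extending that of $F(X)$, $(a,\gamma)\in\overline{F}\times v\overline{F}(X)$ is a pair of definition for $v$ over $F$ if $v=v_{a,\gamma}$ on $\overline{F}(X)$. It is a minimal pair of definition over $F$ if moreover $[F(a):F]\le[F(b):F]$ for all $b\in\overline{F}$ with $v(a-b)\ge\gamma$. Pseudo-Cauchy sequences (pCs): $\{z_\nu\}_{\nu<\lambda}$ ($\lambda$ a limit ordinal) is a pCs if $v(z_{\nu_1}-z_{\nu_2})<v(z_{\nu_2}-z_{\nu_3})$ for $\nu_1<\nu_2<\nu_3$; $y$ is a limit if $v(y-z_\nu)=v(z_\nu-z_{\nu+1})$ for all $\nu$. The induced extension $(\widehat{K}(X)|\widehat{K},\widehat{w})$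 (with respect to $\overline{\widehat{v}}$ and $\overline{w}$) is the restriction to $\widehat{K}(X)$ of the following common extension $\overline{\widehat{w}}$ of $\overline{\widehat{v}}$ and $\overline{w}$ to $\overline{\widehat{K}}(X)$ (independent of the choices made). (1) If $w$ is valuation transcendental, take a pair of definition $(a,\gamma)$ for $\overline{w}$ over $K$ and put $\overline{\widehat{w}}:=\overline{\widehat{v}}_{a,\gamma}$. (2) If $w$ is valuation algebraic, take a strictly increasing cofinal sequence $\{\gamma_\nu\}_{\nu<\lambda}$ in $\{\overline{w}(X-c)\mid c\in\overline{K}\}$ ($\lambda$ a limit ordinal) and $a_\nu\in\overline{K}$ with $\overline{w}(X-a_\nu)=\gamma_\nu$. (2a) If the pCs $\{a_\nu\}$ has a limit $a\in\overline{\widehat{K}}$, put $\overline{\widehat{w}}:=\overline{\widehat{v}}_{a,\gamma}$ with $\gamma=(1,0)\in(\mathbb{Z}\oplus\overline{v}\overline{K})_{\mathrm{lex}}$, where $\overline{v}\overline{K}$ is embedded by $\alpha\mapsto(0,\alpha)$. (2b) Otherwise $\overline{\widehat{w}}$ is the unique extension of $\overline{\widehat{v}}$ to $\overline{\widehat{K}}(X)$ for which $X$ is a limit of $\{a_\nu\}$. Pairs of definition for $\widehat{w}$ over $\widehat{K}$ are taken with respect to $\overline{\widehat{w}}$, and likewise for $\widehat{w}_1$. The values of $\overline{w}$ and $\overline{w}_1$ are both viewed in the divisible hull of $wK(X)$, so the same $\gamma$ makes sense for both; in case (2a) $\gamma=(1,0)$. *)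

theory Defs
  imports
    "HOL-Algebra.Algebraic_Closure_Type"
    "HOL-Algebra.Generated_Fields"
    "HOL-Computational_Algebra.Normalized_Fraction"
    "HOL-Library.Extended"
    "HOL-Library.Product_Plus"
    "HOL-Library.Product_Lexorder"
begin

text \<open>
  Every field in sight is a subfield (a set) of one of two ambient types: the type \<open>'a\<close>, which plays
  the role of the algebraic closure of the completion, and the type \<open>'a poly fract\<close> of rational
  functions over it. The constant \<^const>\<open>ring_of_type_algebra\<close> turns an ambient type into a record,
  so that the notions of subfield, generated subfield, degree, algebraic element, minimal polynomial
  and quotient ring are those of HOL-Algebra.

  The restriction of a valuation to a subfield is not a new function: all notions below take the
  field on which the valuation is to be considered as an argument and do not look outside of it.
\<close>

abbreviation ambient :: "'c::field ring" where
  "ambient \<equiv> ring_of_type_algebra"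


section \<open>Valuations\<close>

instance prod :: (linordered_ab_group_add, linordered_ab_group_add) linordered_ab_group_add
  by standard (auto simp: less_eq_prod_def)

text \<open>The value \<open>\<infinity>\<close> is \<^const>\<open>Pinf\<close>; the second infinite element of \<^typ>\<open>'g extended\<close> is excluded.\<close>

definition valuation_on :: "'c::field set \<Rightarrow> ('c \<Rightarrow> 'g::linordered_ab_group_add extended) \<Rightarrow> bool" where
  "valuation_on F v \<longleftrightarrow>
     (\<forall>x\<in>F. v x \<noteq> Minf \<and> (v x = Pinf \<longleftrightarrow> x = 0)) \<and>
     (\<forall>x\<in>F. \<forall>y\<in>F. v (x * y) = v x + v y \<and> min (v x) (v y) \<le> v (x + y))"

definition value_group :: "('c::field \<Rightarrow> 'g::linordered_ab_group_add extended) \<Rightarrow> 'c set \<Rightarrow> 'g set" where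
  "value_group v F = {\<alpha>. \<exists>x\<in>F. v x = Fin \<alpha>}"

definition valuation_ring :: "('c::field \<Rightarrow> 'g::linordered_ab_group_add extended) \<Rightarrow> 'c set \<Rightarrow> 'c ring" where
  "valuation_ring v F = ambient\<lparr>carrier := {x \<in> F. 0 \<le> v x}\<rparr>"

definition valuation_ideal :: "('c::field \<Rightarrow> 'g::linordered_ab_group_add extended) \<Rightarrow> 'c set \<Rightarrow> 'c set" where
  "valuation_ideal v F = {x \<in> F. 0 < v x}"

definition residue_field :: "('c::field \<Rightarrow> 'g::linordered_ab_group_add extended) \<Rightarrow> 'c set \<Rightarrow> 'c set ring" where
  "residue_field v F = valuation_ring v F Quot valuation_ideal v F"

text \<open>For \<open>F \<subseteq> L\<close>, the residue field of \<open>F\<close> as a subfield of the residue field of \<open>L\<close>.\<close>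

definition residue_subfield ::
    "('c::field \<Rightarrow> 'g::linordered_ab_group_add extended) \<Rightarrow> 'c set \<Rightarrow> 'c set \<Rightarrow> 'c set set" where
  "residue_subfield v L F =
     (\<lambda>x. valuation_ideal v L +>\<^bsub>valuation_ring v L\<^esub> x) ` carrier (valuation_ring v F)"


section \<open>Density and completion\<close>

definition dense_in :: "'c::field set \<Rightarrow> 'c set \<Rightarrow> ('c \<Rightarrow> 'g::linordered_ab_group_add extended) \<Rightarrow> bool" where
  "dense_in K L v \<longleftrightarrow> (\<forall>a\<in>L. \<forall>\<gamma>\<in>value_group v L. \<exists>b\<in>K. Fin \<gamma> < v (a - b))"

definition const :: "'a::field \<Rightarrow> 'a poly fract" where
  "const c = to_fract [:c:]"

definition indet :: "'a::field poly fract" where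
  "indet = to_fract [:0, 1:]"

definition ratfuns :: "'a::field set \<Rightarrow> 'a poly fract set" where
  "ratfuns F = generate_field ambient (insert indet (const ` F))"

text \<open>
  The completion is the maximal extension in which \<open>K\<close> is dense: no proper extension field of
  \<open>Kh\<close> carries an extension of \<open>vh\<close> for which \<open>K\<close> is dense. When \<open>'a\<close> is an algebraic closure of
  \<open>Kh\<close>, it is no restriction that the competing extensions \<open>L\<close> range over the subfields of
  \<^typ>\<open>'a poly fract\<close> only: if \<open>K\<close> is dense in some proper extension of \<open>Kh\<close>, then also in
  \<open>Kh(x)\<close> for every element \<open>x \<notin> Kh\<close> of it, and \<open>Kh(x)\<close> embeds over \<open>Kh\<close> into \<open>'a\<close> if \<open>x\<close> is
  algebraic over \<open>Kh\<close>, and is isomorphic over \<open>Kh\<close> to \<^term>\<open>ratfuns Kh\<close> if it is not. Nor is it a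
  restriction that the values lie in \<open>'g\<close>: density of \<open>K\<close> in \<open>L\<close> makes the value groups equal.
\<close>

definition is_completion ::
    "'a::field set \<Rightarrow> ('a \<Rightarrow> 'g::linordered_ab_group_add extended) \<Rightarrow> 'a set \<Rightarrow> ('a \<Rightarrow> 'g extended) \<Rightarrow> bool" where
  "is_completion K v Kh vh \<longleftrightarrow>
     subfield Kh ambient \<and> K \<subseteq> Kh \<and>
     valuation_on Kh vh \<and> (\<forall>x\<in>K. vh x = v x) \<and> dense_in K Kh vh \<and>
     (\<forall>L (u :: 'a poly fract \<Rightarrow> 'g extended).
        subfield L ambient \<and> const ` Kh \<subseteq> L \<and>
        valuation_on L u \<and> (\<forall>x\<in>Kh. u (const x) = vh x) \<and> dense_in (const ` K) L u
        \<longrightarrow> L = const ` Kh)"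


section \<open>Algebraic closure, degree, conjugates\<close>

definition alg_cl :: "'a::field set \<Rightarrow> 'a set" where
  "alg_cl F = {x. ring.algebraic ambient F x}"

definition simple_degree :: "'a::field set \<Rightarrow> 'a \<Rightarrow> nat" where
  "simple_degree F a = ring.dim ambient F (generate_field ambient (insert a F))"

definition conjugate_over :: "'a::field set \<Rightarrow> 'a \<Rightarrow> 'a \<Rightarrow> bool" where
  "conjugate_over F a b \<longleftrightarrow> a \<in> alg_cl F \<and> b \<in> alg_cl F \<and> ring.Irr ambient F a = ring.Irr ambient F b"


section \<open>Valuation transcendental and valuation algebraic extensions\<close>

definition nat_mult :: "nat \<Rightarrow> 'g::ab_group_add \<Rightarrow> 'g" where
  "nat_mult n x = (\<Sum>i<n. x)"

definition int_mult :: "int \<Rightarrow> 'g::ab_group_add \<Rightarrow> 'g" where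
  "int_mult k x = nat_mult (nat k) x - nat_mult (nat (- k)) x"

text \<open>
  The dimension over the rationals of \<open>(A/B) \<otimes> \<rat>\<close> is \<open>n\<close>. The elements \<open>s \<otimes> 1\<close> with \<open>s \<in> A\<close>
  generate the tensor product, so it has a basis of such elements; linear independence and spanning
  are written out with denominators cleared, an element of \<open>A\<close> vanishing in the tensor product if
  and only if some positive multiple of it lies in \<open>B\<close>.
\<close>

definition has_rational_rank :: "'g::ab_group_add set \<Rightarrow> 'g set \<Rightarrow> nat \<Rightarrow> bool" where
  "has_rational_rank A B n \<longleftrightarrow>
     (\<exists>S. S \<subseteq> A \<and> finite S \<and> card S = n \<and>
        (\<forall>k. (\<Sum>s\<in>S. int_mult (k s) s) \<in> B \<longrightarrow> (\<forall>s\<in>S. k s = 0)) \<and>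
        (\<forall>x\<in>A. \<exists>m>0. \<exists>k. int_mult m x - (\<Sum>s\<in>S. int_mult (k s) s) \<in> B))"

definition has_trdeg :: "'r ring \<Rightarrow> 'r set \<Rightarrow> nat \<Rightarrow> bool" where
  "has_trdeg E k n \<longleftrightarrow>
     (\<exists>S. S \<subseteq> carrier E \<and> finite S \<and> card S = n \<and>
        (\<forall>s\<in>S. ring.transcendental E (generate_field E (k \<union> (S - {s}))) s) \<and>
        (\<forall>x\<in>carrier E. ring.algebraic E (generate_field E (k \<union> S)) x))"

text \<open>The extension \<open>(F(X)|F, w)\<close>; \<open>w\<close> need only be a valuation on \<^term>\<open>ratfuns F\<close>.\<close>

definition value_transcendental ::
    "'a::field set \<Rightarrow> ('a poly fract \<Rightarrow> 'g::linordered_ab_group_add extended) \<Rightarrow> bool" where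
  "value_transcendental F w \<longleftrightarrow>
     has_rational_rank (value_group w (ratfuns F)) (value_group w (const ` F)) 1"

definition residue_transcendental ::
    "'a::field set \<Rightarrow> ('a poly fract \<Rightarrow> 'g::linordered_ab_group_add extended) \<Rightarrow> bool" where
  "residue_transcendental F w \<longleftrightarrow>
     has_trdeg (residue_field w (ratfuns F)) (residue_subfield w (ratfuns F) (const ` F)) 1"

definition valuation_transcendental ::
    "'a::field set \<Rightarrow> ('a poly fract \<Rightarrow> 'g::linordered_ab_group_add extended) \<Rightarrow> bool" where
  "valuation_transcendental F w \<longleftrightarrow> value_transcendental F w \<or> residue_transcendental F w"

definition valuation_algebraic ::
    "'a::field set \<Rightarrow> ('a poly fract \<Rightarrow> 'g::linordered_ab_group_add extended) \<Rightarrow> bool" where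
  "valuation_algebraic F w \<longleftrightarrow> \<not> valuation_transcendental F w"


section \<open>Pairs of definition\<close>

text \<open>
  \<open>w\<close> is the valuation \<open>v\<^bsub>a,\<gamma>\<^esub>\<close> on \<open>E(X)\<close>. The coefficients \<open>C\<^sub>i\<close> in \<open>p = \<Sum> C\<^sub>i (X - a)\<^sup>i\<close> are the
  coefficients of \<open>p(X + a)\<close>.
\<close>

definition is_monomial_valuation ::
    "'a::field set \<Rightarrow> ('a \<Rightarrow> 'g::linordered_ab_group_add extended) \<Rightarrow> 'a \<Rightarrow> 'g \<Rightarrow>
     ('a poly fract \<Rightarrow> 'g extended) \<Rightarrow> bool" where
  "is_monomial_valuation E v a \<gamma> w \<longleftrightarrow>
     valuation_on (ratfuns E) w \<and>
     (\<forall>p. (\<forall>i. poly.coeff p i \<in> E) \<longrightarrow>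
        w (to_fract p) =
          Min ((\<lambda>i. v (poly.coeff (pcompose p [:a, 1:]) i) + Fin (nat_mult i \<gamma>)) ` {..Polynomial.degree p}))"

text \<open>Here \<open>w\<close> is a valuation on \<open>E(X)\<close>, where \<open>E\<close> is the algebraic closure of \<open>F\<close>.\<close>

definition pair_of_definition ::
    "'a::field set \<Rightarrow> ('a poly fract \<Rightarrow> 'g::linordered_ab_group_add extended) \<Rightarrow> 'a \<Rightarrow> 'g \<Rightarrow> bool" where
  "pair_of_definition F w a \<gamma> \<longleftrightarrow>
     a \<in> alg_cl F \<and> \<gamma> \<in> value_group w (ratfuns (alg_cl F)) \<and>
     is_monomial_valuation (alg_cl F) (\<lambda>c. w (const c)) a \<gamma> w"

definition minimal_pair_of_definition ::
    "'a::field set \<Rightarrow> ('a poly fract \<Rightarrow> 'g::linordered_ab_group_add extended) \<Rightarrow> 'a \<Rightarrow> 'g \<Rightarrow> bool" where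
  "minimal_pair_of_definition F w a \<gamma> \<longleftrightarrow>
     pair_of_definition F w a \<gamma> \<and>
     (\<forall>b\<in>alg_cl F. Fin \<gamma> \<le> w (const (a - b)) \<longrightarrow> simple_degree F a \<le> simple_degree F b)"


section \<open>The induced extension\<close>

text \<open>
  A limit ordinal is represented by a nonempty well-order \<open>r\<close> without greatest element, and a sequence
  indexed by it by a function on the field of \<open>r\<close>.
\<close>

definition limit_order :: "'i rel \<Rightarrow> bool" where
  "limit_order r \<longleftrightarrow>
     Well_order r \<and> Field r \<noteq> {} \<and> (\<forall>\<nu>\<in>Field r. \<exists>\<mu>. (\<nu>, \<mu>) \<in> r \<and> \<mu> \<noteq> \<nu>)"

definition pCs_limit ::
    "('c::field \<Rightarrow> 'g::linordered_ab_group_add extended) \<Rightarrow> 'i rel \<Rightarrow> ('i \<Rightarrow> 'c) \<Rightarrow> 'c \<Rightarrow> bool" where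
  "pCs_limit v r z y \<longleftrightarrow>
     (\<forall>\<nu>\<in>Field r. v (y - z \<nu>) = v (z \<nu> - z (wo_rel.suc r {\<nu>})))"

definition strict_cofinal_seq :: "'i rel \<Rightarrow> ('i \<Rightarrow> 'h::order) \<Rightarrow> 'h set \<Rightarrow> bool" where
  "strict_cofinal_seq r g \<Gamma> \<longleftrightarrow>
     g ` Field r \<subseteq> \<Gamma> \<and>
     (\<forall>\<mu> \<nu>. (\<mu>, \<nu>) \<in> r \<and> \<mu> \<noteq> \<nu> \<longrightarrow> g \<mu> < g \<nu>) \<and>
     (\<forall>\<delta>\<in>\<Gamma>. \<exists>\<nu>\<in>Field r. \<delta> \<le> g \<nu>)"

text \<open>The embedding \<open>\<alpha> \<mapsto> (0, \<alpha>)\<close> into the lexicographic product with the integers.\<close>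

abbreviation lex_embed :: "'g::linordered_ab_group_add extended \<Rightarrow> (int \<times> 'g) extended" where
  "lex_embed \<equiv> map_extended (Pair 0)"

text \<open>
  \<open>W\<close> is a common extension of \<open>vhb\<close> and \<open>wb\<close> to \<open>'a poly fract\<close> obtained from some choice of the
  data in the construction; the induced extension is its restriction to the rational functions over
  the completion. In order to treat all cases uniformly, \<open>W\<close> takes its values in the lexicographic
  product with the integers throughout; only in the case that there is a limit are
  values with nonzero first component used.

  Well-orders on subsets of \<open>'g\<close> represent all the ordinals needed, since a strictly increasing
  sequence of values of \<open>wb (X - c)\<close>, all of them finite, is indexed injectively by \<open>'g\<close>.
\<close>

definition is_induced_extension ::
    "'a::field set \<Rightarrow> ('a \<Rightarrow> 'g::linordered_ab_group_add extended) \<Rightarrow>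
     ('a poly fract \<Rightarrow> 'g extended) \<Rightarrow> ('a poly fract \<Rightarrow> (int \<times> 'g) extended) \<Rightarrow> bool" where
  "is_induced_extension K vhb wb W \<longleftrightarrow>
     (if valuation_transcendental K wb
      then \<exists>a \<gamma>. pair_of_definition K wb a \<gamma> \<and>
             is_monomial_valuation UNIV (\<lambda>c. lex_embed (vhb c)) a (0, \<gamma>) W
      else \<exists>(r :: 'g rel) g z. limit_order r \<and>
             strict_cofinal_seq r g {wb (indet - const c) | c. c \<in> alg_cl K} \<and>
             (\<forall>\<nu>\<in>Field r. z \<nu> \<in> alg_cl K \<and> wb (indet - const (z \<nu>)) = g \<nu>) \<and>
             (if \<exists>a. pCs_limit vhb r z a
              then \<exists>a. pCs_limit vhb r z a \<and>
                     is_monomial_valuation UNIV (\<lambda>c. lex_embed (vhb c)) a (1, 0) W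
              else valuation_on UNIV W \<and> (\<forall>c. W (const c) = lex_embed (vhb c)) \<and>
                   pCs_limit W r (\<lambda>\<nu>. const (z \<nu>)) indet))"

end

theory Submission
  imports Defs
begin

text \<open>
  Monomial valuations \<open>v\<^bsub>a,\<gamma>\<^esub>\<close> that agree on \<open>K(X)\<close> and have the same \<open>\<gamma>\<close> also agree on \<open>Kh(X)\<close>: if \<open>\<gamma>\<close> is
  bounded by a value of \<open>K\<close>, polynomials over \<open>Kh\<close> are approximated coefficientwise over \<open>K\<close>; if it is
  not, \<open>w\<close> determines \<open>v(g(a))\<close> for \<open>g\<close> over \<open>K\<close>, hence by density for the Taylor coefficients at \<open>a\<close> of
  a polynomial over \<open>Kh\<close>. That both have the same \<open>\<gamma>\<close>, and that the best
  approximations of \<open>X\<close> are conjugate, follows from Newton polygons and does not need the conjugacy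
  theorem for extensions of valuations: for \<open>f\<close> over the base field, the values \<open>w(X - c)\<close> at the roots \<open>c\<close> of \<open>f\<close>
  are the slopes of \<open>f(X + Y)\<close> as a polynomial in \<open>Y\<close>, whose coefficients are polynomials
  in \<open>X\<close> over the base field. If the pseudo-Cauchy sequence has no limit, every element of \<open>Kh(X)\<close> is
  approximated by a constant, so the induced extension is valuation algebraic; this cannot
  happen for just one of the two extensions, since a limit \<open>a\<close> of the other sequence is a root of a
  polynomial over \<open>Kh\<close>, on whose approximations over \<open>K\<close> the two valuations would differ.
\<close>

subsection \<open>Subfields of the ambient fields\<close>

text \<open>The case split compares \<open>\<gamma>\<close> with the set \<open>\<Gamma>\<close> of
  values of \<open>K\<close>, not the shapes \<open>(0, \<gamma>)\<close> and \<open>(1, 0)\<close>: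
  the \<open>\<gamma>\<close> of a pair of definition for \<open>wb\<close> may itself exceed every
  value of \<open>K\<close>. That \<open>\<Gamma>\<close> is a good yardstick rests on its being
  cofinal in the values of all constants: the ambient field is algebraic over \<open>Kh\<close>, and
  by density \<open>Kh\<close> has no new values. For \<open>\<gamma>\<close> above
  \<open>\<Gamma>\<close>, approximating \<open>p\<close> over \<open>K\<close> need not preserve
  \<open>W p\<close>: if \<open>p\<close> vanishes at the centre \<open>a\<close>, then
  \<open>W p\<close> lies above \<open>\<Gamma>\<close>, and the error of an approximation in
  general does not. Hence only Taylor coefficients, which are constants, are compared. For bounded
  \<open>\<gamma>\<close> the obstacle is cancellation: \<open>W\<close> measures \<open>p\<close>
  around \<open>a\<close>, while approximation controls the coefficients around 0; the discrepancy
  has to be bounded in \<open>\<Gamma>\<close>. Comparisons of the two extensions are proved as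
  one-sided statements; since the assumptions are symmetric, exchanging \<open>W\<close> and
  \<open>W1\<close> gives the converse.\<close>

lemma ambient_simps [simp]:
  "carrier (ambient :: 'c::field ring) = UNIV"
  "x \<otimes>\<^bsub>ambient\<^esub> y = x * (y :: 'c)" "\<one>\<^bsub>ambient\<^esub> = (1 :: 'c)"
  "x \<oplus>\<^bsub>ambient\<^esub> y = x + (y :: 'c)" "\<zero>\<^bsub>ambient\<^esub> = (0 :: 'c)"
  by (simp_all add: ring_of_type_algebra_def)

interpretation ambient: domain "ambient :: 'c::field ring"
  using field_from_type_algebra by (rule field.axioms)

lemma ambient_a_inv [simp]: "\<ominus>\<^bsub>ambient\<^esub> x = - (x :: 'c::field)"
  by (metis UNIV_I add.right_inverse ambient.minus_equality ambient_simps(1,4,5) add.commute)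

lemma ambient_m_inv [simp]: "x \<noteq> 0 \<Longrightarrow> inv\<^bsub>ambient\<^esub> x = inverse (x :: 'c::field)"
  by (rule ambient.comm_inv_char) auto

lemma ambient_nat_pow [simp]: "x [^]\<^bsub>ambient\<^esub> (n :: nat) = (x :: 'c::field) ^ n"
  by (induction n) (auto simp: mult.commute)

lemma subfield_ambient_iff:
  "subfield F (ambient :: 'c::field ring) \<longleftrightarrow>
     1 \<in> F \<and> (\<forall>x\<in>F. \<forall>y\<in>F. x * y \<in> F \<and> x + y \<in> F) \<and> (\<forall>x\<in>F. - x \<in> F) \<and> (\<forall>x\<in>F. inverse x \<in> F)"
    (is "_ \<longleftrightarrow> ?R")
proof
  assume F: "subfield F (ambient :: 'c ring)"
  note s = subringE[OF subfieldE(1)[OF F], simplified]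
  have "inverse x \<in> F" if "x \<in> F" for x
    using ambient.subfield_m_inv(1)[OF F, of x] that s(2) by (cases "x = 0") auto
  with s show ?R by auto
next
  assume ?R
  then show "subfield F (ambient :: 'c ring)"
    by (intro field.subfieldI' field_from_type_algebra ambient.subringI) auto
qed

lemma
  assumes "subfield F (ambient :: 'c::field ring)"
  shows subfield_one: "1 \<in> F"
    and subfield_zero: "0 \<in> F"
    and subfield_mult: "x \<in> F \<Longrightarrow> y \<in> F \<Longrightarrow> x * y \<in> F"
    and subfield_add: "x \<in> F \<Longrightarrow> y \<in> F \<Longrightarrow> x + y \<in> F"
    and subfield_uminus: "x \<in> F \<Longrightarrow> - x \<in> F"
    and subfield_diff: "x \<in> F \<Longrightarrow> y \<in> F \<Longrightarrow> x - y \<in> F"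
    and subfield_inverse: "x \<in> F \<Longrightarrow> inverse x \<in> F"
    and subfield_divide: "x \<in> F \<Longrightarrow> y \<in> F \<Longrightarrow> x / y \<in> F"
proof -
  note R = assms[unfolded subfield_ambient_iff]
  show "1 \<in> F" "x \<in> F \<Longrightarrow> y \<in> F \<Longrightarrow> x * y \<in> F" "x \<in> F \<Longrightarrow> y \<in> F \<Longrightarrow> x + y \<in> F"
    "x \<in> F \<Longrightarrow> - x \<in> F" "x \<in> F \<Longrightarrow> inverse x \<in> F"
    using R by auto
  show "0 \<in> F" using R by (metis add.right_inverse)
  show "x \<in> F \<Longrightarrow> y \<in> F \<Longrightarrow> x - y \<in> F" using R by (metis diff_conv_add_uminus)
  show "x \<in> F \<Longrightarrow> y \<in> F \<Longrightarrow> x / y \<in> F" using R by (simp add: divide_inverse)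
qed

lemma subfield_power: "subfield F (ambient :: 'c::field ring) \<Longrightarrow> x \<in> F \<Longrightarrow> x ^ n \<in> F"
  by (induction n) (auto intro: subfield_one subfield_mult)

lemma subfield_UNIV: "subfield UNIV (ambient :: 'c::field ring)"
  by (simp add: subfield_ambient_iff)

lemma subfield_generate_field: "subfield (generate_field ambient H) (ambient :: 'c::field ring)"
  by (rule field.generate_field_is_subfield) (simp_all add: field_from_type_algebra)

lemma generate_field_least:
  assumes "H \<subseteq> F" "subfield F (ambient :: 'c::field ring)"
  shows "generate_field ambient H \<subseteq> F"
proof
  fix x assume "x \<in> generate_field (ambient :: 'c ring) H"
  then show "x \<in> F"
    by induction (use assms in \<open>auto simp: subfield_ambient_iff\<close>)
qed

lemma subfield_alg_cl: "subfield F ambient \<Longrightarrow> subfield (alg_cl F) ambient"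
  using field.subfield_of_algebraics[OF field_from_type_algebra, of F] by (simp add: alg_cl_def over_def)

lemma subset_alg_cl: "subfield F ambient \<Longrightarrow> F \<subseteq> alg_cl F"
  using ambient.algebraic_self[OF subfieldE(1)] by (auto simp: alg_cl_def over_def)


subsection \<open>Polynomials over a subfield\<close>

definition polys_over :: "'c::field set \<Rightarrow> 'c poly set" where
  "polys_over F = {p. \<forall>i. poly.coeff p i \<in> F}"

lemma coeff_polys_over: "p \<in> polys_over F \<Longrightarrow> poly.coeff p i \<in> F"
  by (simp add: polys_over_def)

lemma polys_over_UNIV [simp]: "polys_over UNIV = UNIV"
  by (simp add: polys_over_def)

lemma subfield_sum: "subfield F (ambient :: 'c::field ring) \<Longrightarrow> (\<And>i. i \<in> I \<Longrightarrow> f i \<in> F) \<Longrightarrow> sum f I \<in> F"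
  by (induction I rule: infinite_finite_induct) (auto intro: subfield_zero subfield_add)

context
  fixes F :: "'c::field set"
  assumes F: "subfield F ambient"
begin

lemma polys_over_pCons: "a \<in> F \<Longrightarrow> p \<in> polys_over F \<Longrightarrow> pCons a p \<in> polys_over F"
  by (auto simp: polys_over_def coeff_pCons split: nat.splits)

lemma polys_over_0: "0 \<in> polys_over F"
  by (simp add: polys_over_def subfield_zero[OF F])

lemma polys_over_const: "a \<in> F \<Longrightarrow> [:a:] \<in> polys_over F"
  by (intro polys_over_pCons polys_over_0)

lemma polys_over_add: "p \<in> polys_over F \<Longrightarrow> q \<in> polys_over F \<Longrightarrow> p + q \<in> polys_over F"
  by (simp add: polys_over_def subfield_add[OF F])

lemma polys_over_uminus: "p \<in> polys_over F \<Longrightarrow> - p \<in> polys_over F"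
  by (simp add: polys_over_def subfield_uminus[OF F])

lemma polys_over_mult: "p \<in> polys_over F \<Longrightarrow> q \<in> polys_over F \<Longrightarrow> p * q \<in> polys_over F"
  by (auto simp: polys_over_def coeff_mult intro!: subfield_sum[OF F] subfield_mult[OF F])

end


subsection \<open>Algebraic elements, degree and conjugates\<close>

text \<open>HOL-Algebra lists the coefficients from the leading one downwards, \<open>Poly\<close>
  from the constant one upwards; hence the reversal here and in the lemmas that follow.\<close>

lemma eval_eq_poly: "ambient.eval p x = poly (Poly (rev p)) (x :: 'c::field)"
proof (induction p)
  case (Cons a p)
  then show ?case
    by (simp add: Poly_append poly_monom mult.commute)
qed simp

lemma carrier_univ_poly_iff:
  "p \<in> carrier (univ_poly (ambient :: 'c::field ring) F) \<longleftrightarrow> p = [] \<or> set p \<subseteq> F \<and> hd p \<noteq> 0"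
  by (auto simp: univ_poly_def polynomial_def)

lemma Poly_rev_polys_over:
  assumes "subfield F ambient" "p \<in> carrier (univ_poly (ambient :: 'c::field ring) F)"
  shows "Poly (rev p) \<in> polys_over F"
  using assms subfield_zero[OF assms(1)]
  by (auto simp: polys_over_def carrier_univ_poly_iff nth_default_def)
     (metis length_rev nth_mem set_rev subsetD)

lemma Poly_rev_neq_0:
  assumes "p \<in> carrier (univ_poly (ambient :: 'c::field ring) F)" "p \<noteq> []"
  shows "Poly (rev p) \<noteq> 0"
proof
  assume "Poly (rev p) = 0"
  then obtain n where "rev p = replicate n 0" by (auto simp: Poly_eq_0)
  then have "p = replicate n 0" by (metis rev_replicate rev_rev_ident)
  with assms show False by (cases n) (auto simp: carrier_univ_poly_iff)
qed

lemma rev_coeffs_carrier: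
  assumes "p \<in> polys_over F"
  shows "rev (coeffs p) \<in> carrier (univ_poly (ambient :: 'c::field ring) F)"
proof (cases "p = 0")
  case False
  then have "hd (rev (coeffs p)) \<noteq> 0"
    by (simp add: hd_rev last_coeffs_eq_coeff_degree)
  moreover have "set (rev (coeffs p)) \<subseteq> F"
    using assms by (auto simp: polys_over_def coeffs_def)
  ultimately show ?thesis by (simp add: carrier_univ_poly_iff)
qed (simp add: carrier_univ_poly_iff)

lemma alg_cl_iff:
  assumes "subfield F ambient"
  shows "c \<in> alg_cl F \<longleftrightarrow> (\<exists>p\<in>polys_over F. p \<noteq> 0 \<and> poly p c = 0)"
proof
  assume "c \<in> alg_cl F"
  then have "(ambient.algebraic over F) c" by (simp add: alg_cl_def over_def)
  then obtain p where "p \<in> carrier (univ_poly ambient F)" "p \<noteq> []" "ambient.eval p c = 0"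
    using ambient.algebraicE[OF subfieldE(1)[OF assms], of c] by auto
  then show "\<exists>p\<in>polys_over F. p \<noteq> 0 \<and> poly p c = 0"
    using Poly_rev_polys_over[OF assms] Poly_rev_neq_0 by (auto simp: eval_eq_poly)
next
  assume "\<exists>p\<in>polys_over F. p \<noteq> 0 \<and> poly p c = 0"
  then obtain p where "p \<in> polys_over F" "p \<noteq> 0" "poly p c = 0" by auto
  then have "(ambient.algebraic over F) c"
    by (intro ambient.algebraicI[OF rev_coeffs_carrier]) (auto simp: eval_eq_poly)
  then show "c \<in> alg_cl F" by (simp add: alg_cl_def over_def)
qed

lemma Irr_neq_Nil:
  assumes "subfield F (ambient :: 'c::field ring)" "(ambient.algebraic over F) c"
  shows "ambient.Irr F c \<noteq> []"
  using ambient.pirreducible_degree[OF assms(1) ambient.IrrE(1,2)[OF assms(1) _ assms(2)]] by auto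

text \<open>A monic irreducible polynomial is the minimal polynomial of each of its roots.\<close>

lemma conjugate_overI:
  assumes F: "subfield F (ambient :: 'c::field ring)" and c: "c \<in> alg_cl F"
    and root: "ambient.eval (ambient.Irr F c) d = 0"
  shows "conjugate_over F c d"
proof -
  have c': "(ambient.algebraic over F) c" using c by (simp add: alg_cl_def over_def)
  note I = ambient.IrrE[OF F _ c']
  have d': "(ambient.algebraic over F) d"
    using I(1) root Irr_neq_Nil[OF F c'] by (intro ambient.algebraicI[of "ambient.Irr F c"]) auto
  have "ambient.Irr F d = ambient.Irr F c"
    using ambient.minimal_polynomial_is_unique[OF F _ d'] ambient.IrrE[OF F _ d'] I root
    by auto
  then show ?thesis using c d' by (simp add: conjugate_over_def alg_cl_def over_def)
qed

text \<open>The minimal polynomial over \<open>E\<close> shared by \<open>c\<close> and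
  \<open>d\<close> divides the minimal polynomial of \<open>c\<close> over \<open>F\<close>, which
  therefore vanishes at \<open>d\<close> too.\<close>

lemma conjugate_over_mono:
  assumes F: "subfield F (ambient :: 'c::field ring)" and E: "subfield E ambient" "F \<subseteq> E"
    and conj: "conjugate_over E c d" and c: "c \<in> alg_cl F"
  shows "conjugate_over F c d"
proof (rule conjugate_overI[OF F c])
  have c': "(ambient.algebraic over F) c" and cE: "(ambient.algebraic over E) c"
    and dE: "(ambient.algebraic over E) d"
    using c conj by (simp_all add: alg_cl_def over_def conjugate_over_def)
  note I = ambient.IrrE[OF F _ c']
  have mem: "ambient.Irr F c \<in> carrier (univ_poly ambient E)"
    using I(1) E(2) by (auto simp: carrier_univ_poly_iff)
  have "ambient.Irr E d pdivides\<^bsub>ambient\<^esub> ambient.Irr F c"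
    using ambient.Irr_minimal[OF E(1) _ cE mem] I(4) conj by (simp add: conjugate_over_def)
  then show "ambient.eval (ambient.Irr F c) d = 0"
    using ambient.pdivides_imp_root_sharing[of "ambient.Irr E d" "ambient.Irr F c" d]
      ambient.IrrE[OF E(1) _ dE] by (auto simp: carrier_univ_poly_iff)
qed

lemma simple_degree_eq:
  assumes F: "subfield F (ambient :: 'c::field ring)" and c: "c \<in> alg_cl F"
  shows "simple_degree F c = length (ambient.Irr F c) - 1"
proof -
  have c': "(ambient.algebraic over F) c" using c by (simp add: alg_cl_def over_def)
  have S: "subfield (ambient.simple_extension F c) ambient"
    using ambient.simple_extension_is_subfield[OF F] c' by simp
  have "generate_field ambient (insert c F) = ambient.simple_extension F c"
  proof
    show "generate_field ambient (insert c F) \<subseteq> ambient.simple_extension F c"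
      using ambient.simple_extension_incl[of F c] ambient.simple_extension_mem[OF subfieldE(1)[OF F], of c]
      by (intro generate_field_least S) auto
    show "ambient.simple_extension F c \<subseteq> generate_field ambient (insert c F)"
      by (rule ambient.simple_extension_subring_incl)
         (auto intro: subfieldE(1) subfield_generate_field generate_field.incl)
  qed
  then show ?thesis
    using ambient.simple_extension_dim[OF F _ c'] by (simp add: simple_degree_def over_def)
qed

lemma simple_degree_conjugate:
  assumes "subfield F (ambient :: 'c::field ring)" "conjugate_over F c d"
  shows "simple_degree F c = simple_degree F d"
  using assms by (simp add: conjugate_over_def simple_degree_eq)

text \<open>The minimal polynomial, in the form needed for Newton polygons: a root that is found
  through its slope alone is then automatically a conjugate.\<close>

lemma poly_with_conjugate_roots:
  assumes F: "subfield F (ambient :: 'c::field ring)" and c: "c \<in> alg_cl F"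
  obtains p where "p \<in> polys_over F" "p \<noteq> 0" "poly p c = 0"
    "\<And>d. poly p d = 0 \<Longrightarrow> conjugate_over F c d"
proof -
  have c': "(ambient.algebraic over F) c" using c by (simp add: alg_cl_def over_def)
  note I = ambient.IrrE[OF F _ c']
  show ?thesis
  proof (rule that[of "Poly (rev (ambient.Irr F c))"])
    show "Poly (rev (ambient.Irr F c)) \<in> polys_over F"
      using I(1) by (intro Poly_rev_polys_over F) auto
    show "Poly (rev (ambient.Irr F c)) \<noteq> 0"
      using I(1) Irr_neq_Nil[OF F c'] by (intro Poly_rev_neq_0[where F = F]) auto
    show "poly (Poly (rev (ambient.Irr F c))) c = 0"
      using I(4) by (simp add: eval_eq_poly)
    show "conjugate_over F c d" if "poly (Poly (rev (ambient.Irr F c))) d = 0" for d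
      using that by (intro conjugate_overI F c) (simp add: eval_eq_poly)
  qed
qed


subsection \<open>Ordered groups with infinity\<close>

lemma nat_mult_0 [simp]: "nat_mult 0 x = 0"
  by (simp add: nat_mult_def)

lemma nat_mult_Suc: "nat_mult (Suc n) x = nat_mult n x + x"
  by (simp add: nat_mult_def)

lemma nat_mult_add: "nat_mult (m + n) x = nat_mult m x + nat_mult n x"
  by (induction n) (simp_all add: nat_mult_Suc add.assoc)

lemma nat_mult_diff: "nat_mult n (x - y) = nat_mult n x - nat_mult n y"
  by (simp add: nat_mult_def sum_subtractf)

lemma nat_mult_mono:
  fixes x y :: "'g::linordered_ab_group_add"
  shows "x \<le> y \<Longrightarrow> nat_mult n x \<le> nat_mult n y"
  unfolding nat_mult_def by (rule sum_mono)

lemma nat_mult_nonneg: "0 \<le> (x :: 'g::linordered_ab_group_add) \<Longrightarrow> 0 \<le> nat_mult n x"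
  using nat_mult_mono[of 0 x n] by (simp add: nat_mult_def)

lemma nat_mult_mono_left:
  fixes x :: "'g::linordered_ab_group_add"
  assumes "m \<le> n" "0 \<le> x" shows "nat_mult m x \<le> nat_mult n x"
  using nat_mult_nonneg[OF assms(2), of "n - m"] nat_mult_add[of m "n - m" x] assms(1) by simp

lemma int_mult_of_nat [simp]: "int_mult (int n) x = nat_mult n x"
  by (simp add: int_mult_def)

lemma nat_mult_le_self:
  fixes x :: "'g::linordered_ab_group_add"
  assumes "x \<le> nat_mult n x \<or> 0 \<le> x" "n > 0" "nat_mult n x \<le> y" "0 \<le> y"
  shows "x \<le> y"
  using assms nat_mult_mono_left[of 1 n x] by (auto simp: nat_mult_Suc)

lemma zero_extended_simps [simp]: "(Fin x = 0) = (x = 0)" "(Fin x \<le> 0) = (x \<le> 0)" "(0 \<le> Fin x) = (0 \<le> x)"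
  "(Fin x < 0) = (x < 0)" "(0 < Fin x) = (0 < x)" "(0::'g::{order,zero} extended) \<noteq> Pinf" "(0::'g extended) \<noteq> Minf"
  "Pinf \<noteq> (0::'g extended)" "Minf \<noteq> (0::'g extended)"
  "(0::'g extended) < Pinf"
  by (simp_all add: zero_extended_def)

lemma extended_add_less_le:
  fixes a :: "'g::linordered_ab_group_add extended"
  assumes "a < b" "Fin c \<le> d" shows "a + Fin c < b + d"
  using assms by (cases a; cases b; cases d) (auto intro: add_less_le_mono)

lemma extended_add_less_cancel [simp]:
  fixes a :: "'g::linordered_ab_group_add extended"
  shows "a + Fin c < b + Fin c \<longleftrightarrow> a < b" "a + Fin c \<le> b + Fin c \<longleftrightarrow> a \<le> b"
    "Fin c + a < Fin c + b \<longleftrightarrow> a < b" "Fin c + a \<le> Fin c + b \<longleftrightarrow> a \<le> b"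
  by (cases a; cases b; simp)+

text \<open>Values of polynomials are described below through their finite lower bounds; this
  recovers the values themselves.\<close>

lemma extended_le_iff_Fin:
  fixes a b :: "'g::linorder extended"
  assumes "a \<noteq> Minf" "b \<noteq> Minf" "a \<noteq> Pinf" "\<And>\<mu>. Fin \<mu> \<le> a \<Longrightarrow> Fin \<mu> \<le> b"
  shows "a \<le> b"
  using assms by (cases a) auto

lemma lex_embed_simps [simp]:
  "lex_embed x = Pinf \<longleftrightarrow> x = Pinf" "lex_embed x = Minf \<longleftrightarrow> x = Minf"
  "lex_embed x \<le> lex_embed y \<longleftrightarrow> x \<le> y" "lex_embed x < lex_embed y \<longleftrightarrow> x < y"
  "lex_embed x = lex_embed y \<longleftrightarrow> x = y"
  by (cases x; cases y; simp)+

lemma lex_embed_add: "lex_embed (x + y) = lex_embed x + lex_embed y"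
  by (cases x; cases y; simp)

lemma lex_embed_min: "lex_embed (min x y) = min (lex_embed x) (lex_embed y)"
  by (simp add: min_def)


subsection \<open>Valuations\<close>

locale valued =
  fixes F :: "'c::field set" and v :: "'c \<Rightarrow> 'g::linordered_ab_group_add extended"
  assumes subfield: "subfield F ambient" and valuation: "valuation_on F v"
begin

lemmas closed [simp, intro] =
  subfield_one[OF subfield] subfield_zero[OF subfield] subfield_mult[OF subfield]
  subfield_add[OF subfield] subfield_uminus[OF subfield] subfield_diff[OF subfield]
  subfield_inverse[OF subfield] subfield_divide[OF subfield] subfield_power[OF subfield]

lemma not_Minf: "x \<in> F \<Longrightarrow> v x \<noteq> Minf"
  and Pinf_iff: "x \<in> F \<Longrightarrow> v x = Pinf \<longleftrightarrow> x = 0"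
  and mult: "x \<in> F \<Longrightarrow> y \<in> F \<Longrightarrow> v (x * y) = v x + v y"
  and add_ge: "x \<in> F \<Longrightarrow> y \<in> F \<Longrightarrow> min (v x) (v y) \<le> v (x + y)"
  using valuation by (auto simp: valuation_on_def)

lemma zero: "v 0 = Pinf"
  using Pinf_iff[of 0] by auto

lemma Fin:
  assumes "x \<in> F" "x \<noteq> 0" obtains \<alpha> where "v x = Fin \<alpha>"
  using not_Minf[OF assms(1)] Pinf_iff[OF assms(1)] assms(2) by (cases "v x") auto

lemma less_Pinf_iff: "x \<in> F \<Longrightarrow> v x < Pinf \<longleftrightarrow> x \<noteq> 0"
  using Pinf_iff[of x] not_Minf[of x] by (cases "v x") auto

lemma one: "v 1 = 0"
proof -
  obtain \<alpha> where "v 1 = Fin \<alpha>" using Fin[of 1] by auto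
  with mult[of 1 1] show ?thesis by (auto simp: zero_extended_def)
qed

lemma uminus: assumes "x \<in> F" shows "v (- x) = v x"
proof -
  obtain \<alpha> where \<alpha>: "v (- 1) = Fin \<alpha>" using Fin[of "-1"] by auto
  have "\<alpha> + \<alpha> = 0" using mult[of "-1" "-1"] one \<alpha> by (auto simp: zero_extended_def)
  then have "v (- 1) = 0" using \<alpha> by simp
  with mult[of "-1" x] assms show ?thesis by auto
qed

lemma minus_commute: "x \<in> F \<Longrightarrow> y \<in> F \<Longrightarrow> v (x - y) = v (y - x)"
  using uminus[of "x - y"] by auto

lemma diff_ge: "x \<in> F \<Longrightarrow> y \<in> F \<Longrightarrow> min (v x) (v y) \<le> v (x - y)"
  using add_ge[of x "- y"] uminus[of y] by auto

lemma add_eq: assumes "x \<in> F" "y \<in> F" "v x < v y" shows "v (x + y) = v x"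
proof (rule antisym)
  show "v x \<le> v (x + y)" using add_ge[of x y] assms by (simp add: min.absorb1)
  have "min (v (x + y)) (v y) \<le> v x" using diff_ge[of "x + y" y] assms by auto
  then show "v (x + y) \<le> v x" using assms(3) by (auto simp: min_def split: if_splits)
qed

lemma eq_of_diff: "x \<in> F \<Longrightarrow> y \<in> F \<Longrightarrow> v x < v (x - y) \<Longrightarrow> v y = v x"
  using add_eq[of x "y - x"] minus_commute[of x y] by auto

lemma diff_eq: "x \<in> F \<Longrightarrow> y \<in> F \<Longrightarrow> v x < v y \<Longrightarrow> v (x - y) = v x"
  using add_eq[of x "- y"] uminus[of y] by auto

lemma inverse: assumes "x \<in> F" "v x = Fin \<alpha>" shows "v (inverse x) = Fin (- \<alpha>)"
proof -
  have "x \<noteq> 0" using assms zero by auto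
  then have "v x + v (inverse x) = 0" using mult[of x "inverse x"] one assms by auto
  then show ?thesis using assms(2)
    by (cases "v (inverse x)") (auto simp: eq_neg_iff_add_eq_0 add.commute)
qed

lemma divide:
  assumes "x \<in> F" "y \<in> F" "v x = Fin \<alpha>" "v y = Fin \<beta>" shows "v (x / y) = Fin (\<alpha> - \<beta>)"
  using mult[of x "inverse y"] inverse[of y \<beta>] assms by (auto simp: divide_inverse)

lemma power: "x \<in> F \<Longrightarrow> v x = Fin \<alpha> \<Longrightarrow> v (x ^ n) = Fin (nat_mult n \<alpha>)"
  by (induction n) (auto simp: one mult nat_mult_Suc add.commute zero_extended_def)

lemma power_ge: assumes "x \<in> F" "Fin \<alpha> \<le> v x" shows "Fin (nat_mult n \<alpha>) \<le> v (x ^ n)"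
proof (cases "x = 0")
  case True
  then show ?thesis by (cases n) (auto simp: zero one)
next
  case False
  then obtain \<beta> where "v x = Fin \<beta>" using Fin assms by auto
  then show ?thesis using assms by (auto simp: power nat_mult_mono)
qed

lemma sum_closed: "(\<And>i. i \<in> I \<Longrightarrow> f i \<in> F) \<Longrightarrow> sum f I \<in> F"
  using subfield by (rule subfield_sum)

lemma sum_gt:
  assumes "\<And>i. i \<in> I \<Longrightarrow> f i \<in> F \<and> Fin \<mu> < v (f i)"
  shows "Fin \<mu> < v (sum f I)"
  using assms
proof (induction I rule: infinite_finite_induct)
  case (insert i I)
  then have "Fin \<mu> < min (v (f i)) (v (sum f I))" by auto
  also have "\<dots> \<le> v (f i + sum f I)" using insert.prems by (intro add_ge sum_closed) auto
  finally show ?case using insert by simp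
qed (auto simp: zero)

lemma sum_dominant:
  assumes "finite I" "j \<in> I" "\<And>i. i \<in> I \<Longrightarrow> f i \<in> F" "f j \<noteq> 0"
    and "\<And>i. i \<in> I - {j} \<Longrightarrow> v (f j) < v (f i)"
  shows "v (sum f I) = v (f j)"
proof -
  obtain \<mu> where \<mu>: "v (f j) = Fin \<mu>" using Fin assms by metis
  have "Fin \<mu> < v (sum f (I - {j}))" using assms \<mu> by (intro sum_gt) auto
  then have "v (f j + sum f (I - {j})) = v (f j)"
    using assms \<mu> by (intro add_eq sum_closed) auto
  then show ?thesis using assms by (simp add: sum.remove)
qed

lemma value_groupI: "x \<in> F \<Longrightarrow> v x = Fin \<alpha> \<Longrightarrow> \<alpha> \<in> value_group v F"
  by (auto simp: value_group_def)

lemma value_groupE: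
  assumes "\<alpha> \<in> value_group v F" obtains x where "x \<in> F" "x \<noteq> 0" "v x = Fin \<alpha>"
proof -
  obtain x where "x \<in> F" "v x = Fin \<alpha>" using assms by (auto simp: value_group_def)
  then show ?thesis by (intro that[of x]) (auto simp: zero)
qed

lemma value_group_zero: "0 \<in> value_group v F"
  using one by (auto intro!: value_groupI[of 1] simp: zero_extended_def)

lemma value_group_diff: "\<alpha> \<in> value_group v F \<Longrightarrow> \<beta> \<in> value_group v F \<Longrightarrow> \<alpha> - \<beta> \<in> value_group v F"
  by (metis closed(8) divide value_groupE value_groupI)

lemma value_group_uminus: "\<alpha> \<in> value_group v F \<Longrightarrow> - \<alpha> \<in> value_group v F"
  using value_group_diff[OF value_group_zero] by simp

lemma value_group_add: "\<alpha> \<in> value_group v F \<Longrightarrow> \<beta> \<in> value_group v F \<Longrightarrow> \<alpha> + \<beta> \<in> value_group v F"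
  using value_group_diff[of \<alpha> "- \<beta>"] value_group_uminus by simp

lemma value_group_nat_mult: "\<alpha> \<in> value_group v F \<Longrightarrow> nat_mult n \<alpha> \<in> value_group v F"
  by (induction n) (auto simp: nat_mult_Suc value_group_zero value_group_add)

end

lemma valued_UNIV: "valuation_on UNIV v \<Longrightarrow> valued UNIV v"
  by (simp add: valued_def subfield_UNIV)

lemma valued_lex_embed: "valued F v \<Longrightarrow> valued F (\<lambda>x. lex_embed (v x))"
  unfolding valued_def valuation_on_def by (auto simp: lex_embed_add simp flip: lex_embed_min)

text \<open>Two terms of an algebraic equation for \<open>c\<close> must have the same value.\<close>

lemma (in valued) torsion_value:
  assumes E: "subfield E ambient" "E \<subseteq> F" and p: "p \<in> polys_over E" "p \<noteq> 0" "poly p c = 0"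
    and c: "c \<in> F" "v c = Fin \<gamma>"
  shows "\<exists>m>0. nat_mult m \<gamma> \<in> value_group v E"
proof -
  interpret E: valued E v
    using E valuation by (intro valued.intro) (auto simp: valuation_on_def)
  define I where "I = {i. poly.coeff p i \<noteq> 0}"
  define f where "f i = poly.coeff p i * c ^ i" for i
  have fin: "finite I" unfolding I_def
    by (rule finite_subset[of _ "{..Polynomial.degree p}"]) (auto simp: le_degree)
  have "Polynomial.degree p \<in> I" using p(2) by (simp add: I_def)
  then have ne: "I \<noteq> {}" by auto
  have c0: "c \<noteq> 0" using c zero by auto
  have mem: "poly.coeff p i \<in> E" "poly.coeff p i \<in> F" for i
    using coeff_polys_over[OF p(1), of i] E(2) by (simp_all add: subsetD)
  have f: "f i \<in> F" for i unfolding f_def using mem c by simp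
  have "sum f I = poly p c"
    unfolding f_def I_def poly_altdef by (rule sum.mono_neutral_left) (auto simp: le_degree)
  then have s: "v (sum f I) = Pinf" using p(3) zero by simp
  obtain j where j: "j \<in> I" "\<And>i. i \<in> I \<Longrightarrow> v (f j) \<le> v (f i)"
    using that[of "arg_min_on (\<lambda>i. v (f i)) I"] arg_min_least[OF fin ne, of _ "\<lambda>i. v (f i)"]
      arg_min_if_finite(1)[OF fin ne, of "\<lambda>i. v (f i)"] by simp
  have "f j \<noteq> 0" using j(1) c0 by (simp add: f_def I_def)
  have "\<exists>i\<in>I - {j}. \<not> v (f j) < v (f i)"
  proof (rule ccontr)
    assume "\<not> ?thesis"
    then have "v (sum f I) = v (f j)"
      using \<open>f j \<noteq> 0\<close> by (intro sum_dominant fin j f) auto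
    with s \<open>f j \<noteq> 0\<close> show False using Pinf_iff[OF f] by simp
  qed
  then have "\<exists>i\<in>I - {j}. v (f i) = v (f j)" using j(2) by force
  then obtain i where i: "i \<in> I" "i \<noteq> j" "v (f i) = v (f j)" by auto
  obtain \<alpha> where a: "v (poly.coeff p i) = Fin \<alpha>"
    using i(1) Fin[OF mem(2)[of i]] unfolding I_def by auto
  obtain \<beta> where b: "v (poly.coeff p j) = Fin \<beta>"
    using j(1) Fin[OF mem(2)[of j]] unfolding I_def by auto
  note ab = a b
  have eq: "\<alpha> + nat_mult i \<gamma> = \<beta> + nat_mult j \<gamma>"
    using i(3) ab power[OF c] mem c(1) by (simp add: f_def mult)
  have ab': "\<alpha> \<in> value_group v E" "\<beta> \<in> value_group v E"
    using E.value_groupI[OF mem(1) a] E.value_groupI[OF mem(1) b] .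
  show ?thesis
  proof (cases "i < j")
    case True
    then have "nat_mult j \<gamma> = nat_mult i \<gamma> + nat_mult (j - i) \<gamma>"
      by (simp flip: nat_mult_add)
    with eq have "nat_mult i \<gamma> + \<alpha> = nat_mult i \<gamma> + (\<beta> + nat_mult (j - i) \<gamma>)"
      by (simp only: add_ac)
    then have "nat_mult (j - i) \<gamma> = \<alpha> - \<beta>" by simp
    with True show ?thesis using E.value_group_diff[OF ab'] by (intro exI[of _ "j - i"]) auto
  next
    case False
    then have "nat_mult i \<gamma> = nat_mult j \<gamma> + nat_mult (i - j) \<gamma>"
      by (simp flip: nat_mult_add)
    with eq have "nat_mult j \<gamma> + (\<alpha> + nat_mult (i - j) \<gamma>) = nat_mult j \<gamma> + \<beta>"
      by (simp only: add_ac)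
    then have "nat_mult (i - j) \<gamma> = \<beta> - \<alpha>" by (metis add_diff_cancel_left' add_left_cancel)
    with False i show ?thesis using E.value_group_diff[OF ab'(2,1)] by (intro exI[of _ "i - j"]) auto
  qed
qed


subsection \<open>Rational functions\<close>

lemma const_simps [simp]:
  "const 0 = 0" "const 1 = 1" "const (a + b) = const a + const b" "const (a - b) = const a - const b"
  "const (- a) = - const a" "const (a * b) = const a * const b" "const a = const b \<longleftrightarrow> a = b"
  "const a = 0 \<longleftrightarrow> a = 0"
  by (simp_all add: const_def one_pCons[symmetric] flip: to_fract_add to_fract_diff to_fract_uminus to_fract_mult)

lemma const_inverse: "const (inverse a) = inverse (const a)"
proof (cases "a = 0")
  case False
  then have "const (inverse a) * const a = 1" by (metis const_simps(2,6) left_inverse)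
  then show ?thesis using False by (metis inverse_unique mult.commute)
qed simp

lemma to_fract_pCons: "to_fract (pCons a p) = const a + indet * to_fract p"
proof -
  have "pCons a p = [:a:] + [:0, 1:] * p" by simp
  then show ?thesis by (simp only: to_fract_add to_fract_mult const_def indet_def)
qed

lemma to_fract_linear: "to_fract [:- c, 1:] = indet - const c"
  by (simp add: to_fract_pCons)

lemma to_fract_smult: "to_fract (smult a p) = const a * to_fract p"
  by (simp add: const_def flip: to_fract_mult)

lemma indet_neq_const: "indet \<noteq> const c"
  by (metis eq_iff_diff_eq_0 pCons_eq_0_iff to_fract_eq_0_iff to_fract_linear zero_neq_one)

lemma to_fract_eq_poly: "to_fract p = poly (map_poly const p) indet"
  by (induction p) (auto simp: to_fract_pCons map_poly_pCons)

lemma const_poly: "const (poly p a) = poly (map_poly const p) (const a)"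
  by (induction p) (auto simp: map_poly_pCons)

lemma coeff_map_poly_const [simp]: "poly.coeff (map_poly const p) i = const (poly.coeff p i)"
  by (rule coeff_map_poly) simp

lemma subfield_ratfuns: "subfield (ratfuns F) ambient"
  unfolding ratfuns_def by (rule subfield_generate_field)

lemma indet_ratfuns: "indet \<in> ratfuns F" and const_ratfuns: "c \<in> F \<Longrightarrow> const c \<in> ratfuns F"
  by (auto simp: ratfuns_def intro: generate_field.incl)

lemma to_fract_ratfuns: "p \<in> polys_over F \<Longrightarrow> to_fract p \<in> ratfuns F"
proof (induction p)
  case (pCons a p)
  then have "a \<in> F" "p \<in> polys_over F"
    using coeff_polys_over[OF pCons.prems, of 0] coeff_polys_over[OF pCons.prems, of "Suc i" for i]
    by (auto simp: polys_over_def)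
  with pCons show ?case
    by (auto simp: to_fract_pCons
        intro!: subfield_add subfield_mult subfield_ratfuns indet_ratfuns const_ratfuns)
qed (simp add: subfield_zero[OF subfield_ratfuns])

lemma ratfuns_eq:
  assumes F: "subfield F ambient"
  shows "ratfuns F = {to_fract p / to_fract q | p q. p \<in> polys_over F \<and> q \<in> polys_over F \<and> q \<noteq> 0}"
    (is "_ = ?R")
proof
  show "?R \<subseteq> ratfuns F"
    by (auto intro!: subfield_divide subfield_ratfuns to_fract_ratfuns)
  have 1: "to_fract p \<in> ?R" if "p \<in> polys_over F" for p
  proof -
    have "1 \<in> polys_over F"
      using polys_over_const[OF F subfield_one[OF F]] by (simp add: one_pCons)
    with that show ?thesis by (intro CollectI exI[of _ p] exI[of _ 1]) simp
  qed
  have 2: "to_fract p / to_fract q \<in> ?R" if "p \<in> polys_over F" "q \<in> polys_over F" for p q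
    using that 1[OF polys_over_0[OF F]] by (cases "q = 0") auto
  have "subfield ?R ambient"
    unfolding subfield_ambient_iff
  proof (intro conjI ballI)
    show "1 \<in> ?R" using 1[OF polys_over_const[OF F subfield_one[OF F]]]
      by (simp add: one_pCons[symmetric])
    fix x assume "x \<in> ?R"
    then obtain p q where x: "x = to_fract p / to_fract q" and pq: "p \<in> polys_over F" "q \<in> polys_over F" "q \<noteq> 0"
      by auto
    have "- x = to_fract (- p) / to_fract q" using x by simp
    then show "- x \<in> ?R" using 2[OF polys_over_uminus[OF F pq(1)] pq(2)] by simp
    have "inverse x = to_fract q / to_fract p" using x by simp
    then show "inverse x \<in> ?R" using 2[OF pq(2,1)] by simp
    fix y assume "y \<in> ?R"
    then obtain r s where y: "y = to_fract r / to_fract s" and rs: "r \<in> polys_over F" "s \<in> polys_over F" "s \<noteq> 0"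
      by auto
    have "x * y = to_fract (p * r) / to_fract (q * s)" using x y by simp
    then show "x * y \<in> ?R" using pq rs by (simp only:) (intro 2 polys_over_mult F)
    have "x + y = to_fract (p * s + r * q) / to_fract (q * s)"
      using x y pq rs by (simp add: add_frac_eq)
    then show "x + y \<in> ?R" using pq rs by (simp only:) (intro 2 polys_over_mult polys_over_add F)
  qed
  moreover have "indet \<in> ?R"
    unfolding indet_def using F by (intro 1 polys_over_pCons polys_over_0 subfield_zero subfield_one)
  moreover have "const ` F \<subseteq> ?R"
    using 1[OF polys_over_const[OF F]] by (auto simp: const_def)
  ultimately show "ratfuns F \<subseteq> ?R"
    unfolding ratfuns_def by (intro generate_field_least) auto
qed

lemma fract_cases:
  fixes x :: "'a::field poly fract"
  obtains p q where "x = to_fract p / to_fract q" "q \<noteq> 0"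
proof -
  obtain p q where "x = Fract p q" "q \<noteq> 0" by (cases x)
  then show ?thesis using that[of p q] by (simp add: to_fract_def)
qed

lemma ratfuns_UNIV: "ratfuns (UNIV :: 'a::field set) = UNIV"
proof -
  have "x \<in> ratfuns UNIV" for x :: "'a poly fract"
    by (cases x rule: fract_cases) (auto simp: ratfuns_eq[OF subfield_UNIV])
  then show ?thesis by auto
qed

lemma polynomial_splits:
  fixes p :: "'a::alg_closed_field poly"
  assumes "p \<noteq> 0"
  obtains A where "p = smult (Polynomial.lead_coeff p) (\<Prod>x\<in>#A. [:- x, 1:])"
    "\<And>x. x \<in># A \<Longrightarrow> poly p x = 0"
proof -
  obtain A where A: "p = smult (Polynomial.lead_coeff p) (\<Prod>x\<in>#A. [:- x, 1:])"
    using alg_closed_imp_factorization[OF assms] by auto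
  have "poly p x = 0" if "x \<in># A" for x
  proof -
    have "poly (\<Prod>x\<in>#A. [:- x, 1:]) x = 0"
      using that by (auto simp: poly_prod_mset prod_mset_zero_iff intro!: image_eqI[of _ _ x])
    then show ?thesis by (subst A) simp
  qed
  with A that show ?thesis by blast
qed


subsection \<open>Monomial valuations\<close>

text \<open>\<open>\<mu>\<close> is a lower bound for the Gauss valuation of slope
  \<open>\<gamma>\<close> centred at 0. Stated for all indices, it does not mention the degree, and
  zero coefficients, having value \<open>Pinf\<close>, satisfy it trivially.\<close>

definition gauss_le :: "('c::field \<Rightarrow> 'g::linordered_ab_group_add extended) \<Rightarrow> 'g \<Rightarrow> 'g \<Rightarrow> 'c poly \<Rightarrow> bool" where
  "gauss_le V \<gamma> \<mu> p \<longleftrightarrow> (\<forall>i. Fin \<mu> \<le> V (poly.coeff p i) + Fin (nat_mult i \<gamma>))"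

lemma Fin_le_add_iff: "Fin \<mu> \<le> x + Fin \<alpha> \<longleftrightarrow> Fin (\<mu> - \<alpha>) \<le> (x :: 'g::linordered_ab_group_add extended)"
  by (cases x) (auto simp: diff_le_eq)

lemma Fin_less_add_iff: "Fin \<mu> < x + Fin \<alpha> \<longleftrightarrow> Fin (\<mu> - \<alpha>) < (x :: 'g::linordered_ab_group_add extended)"
  by (cases x) (auto simp: diff_less_eq)

lemma gauss_le_pCons: "gauss_le V \<gamma> \<mu> (pCons c p) \<longleftrightarrow> Fin \<mu> \<le> V c \<and> gauss_le V \<gamma> (\<mu> - \<gamma>) p"
proof -
  have "(\<forall>i. R i) \<longleftrightarrow> R 0 \<and> (\<forall>i. R (Suc i))" for R
    by (metis nat.exhaust)
  from this[of "\<lambda>i. Fin (\<mu> - nat_mult i \<gamma>) \<le> V (poly.coeff (pCons c p) i)"] show ?thesis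
    unfolding gauss_le_def Fin_le_add_iff by (simp add: nat_mult_Suc diff_diff_eq add.commute)
qed

context valued
begin

lemma gauss_le_add:
  assumes "F = UNIV" "gauss_le v \<gamma> \<mu> p" "gauss_le v \<gamma> \<mu> q"
  shows "gauss_le v \<gamma> \<mu> (p + q)"
  unfolding gauss_le_def Fin_le_add_iff
proof
  fix i
  have "Fin (\<mu> - nat_mult i \<gamma>) \<le> min (v (poly.coeff p i)) (v (poly.coeff q i))"
    using assms(2,3) unfolding gauss_le_def Fin_le_add_iff by simp
  also have "\<dots> \<le> v (poly.coeff (p + q) i)" using add_ge[of "poly.coeff p i" "poly.coeff q i"] assms(1) by simp
  finally show "Fin (\<mu> - nat_mult i \<gamma>) \<le> v (poly.coeff (p + q) i)" .
qed

lemma gauss_le_smult: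
  assumes "F = UNIV" "gauss_le v \<gamma> (\<mu> - \<delta>) p" "Fin \<delta> \<le> v d"
  shows "gauss_le v \<gamma> \<mu> (smult d p)"
  unfolding gauss_le_def Fin_le_add_iff
proof
  fix i
  have "Fin (\<mu> - \<delta> - nat_mult i \<gamma>) \<le> v (poly.coeff p i)"
    using assms(2) unfolding gauss_le_def Fin_le_add_iff by simp
  then have "Fin \<delta> + Fin (\<mu> - \<delta> - nat_mult i \<gamma>) \<le> v d + v (poly.coeff p i)"
    using assms(3) by (rule add_mono[rotated])
  then show "Fin (\<mu> - nat_mult i \<gamma>) \<le> v (poly.coeff (smult d p) i)"
    using assms(1) by (simp add: mult)
qed

text \<open>In Horner form, the shifted polynomial is \<open>c + d * q + X * q\<close>.
  Multiplication by \<open>d\<close> raises bounds at least as much as multiplication by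
  \<open>X\<close>, namely by \<open>\<gamma>\<close>.\<close>

lemma gauss_le_shift:
  assumes U: "F = UNIV" and d: "Fin \<gamma> \<le> v d"
  shows "gauss_le v \<gamma> \<mu> p \<Longrightarrow> gauss_le v \<gamma> \<mu> (pcompose p [:d, 1:])"
proof (induction p arbitrary: \<mu>)
  case 0
  then show ?case by simp
next
  case (pCons c p)
  let ?q = "pcompose p [:d, 1:]"
  have c: "Fin \<mu> \<le> v c" and q: "gauss_le v \<gamma> (\<mu> - \<gamma>) ?q"
    using pCons by (auto simp: gauss_le_pCons)
  have 0: "gauss_le v \<gamma> \<nu> 0" for \<nu>
    by (simp add: gauss_le_def zero)
  have "pcompose (pCons c p) [:d, 1:] = [:c:] + (smult d ?q + pCons 0 ?q)"
    by (simp add: pcompose_pCons)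
  moreover have "gauss_le v \<gamma> \<mu> [:c:]" using c 0 by (simp add: gauss_le_pCons)
  moreover have "gauss_le v \<gamma> \<mu> (pCons 0 ?q)" using q by (simp add: gauss_le_pCons zero)
  moreover have "gauss_le v \<gamma> \<mu> (smult d ?q)" using gauss_le_smult[OF U q d] .
  ultimately show ?case using gauss_le_add[OF U] by simp
qed

lemma Min_gauss:
  assumes "Polynomial.degree q \<le> n"
  shows "Fin \<mu> \<le> Min ((\<lambda>i. v (poly.coeff q i) + Fin (nat_mult i \<gamma>)) ` {..n}) \<longleftrightarrow> gauss_le v \<gamma> \<mu> q"
proof -
  have "Fin \<mu> \<le> v (poly.coeff q i) + Fin (nat_mult i \<gamma>)" if "\<not> i \<le> n" for i
    using that assms by (simp add: coeff_eq_0 zero)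
  then show ?thesis by (auto simp: gauss_le_def)
qed

text \<open>Substituting \<open>X + a\<close> preserves the degree, so for a nonzero polynomial both
  the minimum and the value of \<open>w\<close> are finite and hence determined by their finite
  lower bounds. This form suits induction and change of centre better than \<open>Min\<close> over a
  range that depends on the degree.\<close>

lemma is_monomial_valuation_iff:
  assumes U: "F = UNIV"
  shows "is_monomial_valuation UNIV v a \<gamma> w \<longleftrightarrow>
    valuation_on UNIV w \<and> (\<forall>p \<mu>. Fin \<mu> \<le> w (to_fract p) \<longleftrightarrow> gauss_le v \<gamma> \<mu> (pcompose p [:a, 1:]))"
    (is "?L \<longleftrightarrow> ?R")
proof
  assume L: ?L
  have "w (to_fract p) = Min ((\<lambda>i. v (poly.coeff (pcompose p [:a, 1:]) i) + Fin (nat_mult i \<gamma>)) `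
      {..Polynomial.degree p})" for p
    using L by (simp add: is_monomial_valuation_def)
  moreover have "Polynomial.degree (pcompose p [:a, 1:]) \<le> Polynomial.degree p" for p
    by (simp add: degree_pcompose)
  ultimately show ?R
    using L Min_gauss unfolding is_monomial_valuation_def ratfuns_UNIV by metis
next
  assume R: ?R
  interpret w: valued UNIV w using R by (intro valued_UNIV) auto
  let ?M = "\<lambda>p. Min ((\<lambda>i. v (poly.coeff (pcompose p [:a, 1:]) i) + Fin (nat_mult i \<gamma>)) ` {..Polynomial.degree p})"
  have "w (to_fract p) = ?M p" for p
  proof (cases "p = 0")
    case True
    then show ?thesis by (simp add: w.zero zero)
  next
    case False
    define q where "q = pcompose p [:a, 1:]"
    have deg: "Polynomial.degree q = Polynomial.degree p" by (simp add: q_def degree_pcompose)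
    have iff: "Fin \<mu> \<le> ?M p \<longleftrightarrow> Fin \<mu> \<le> w (to_fract p)" for \<mu>
      using R Min_gauss[of q "Polynomial.degree p" \<mu> \<gamma>] deg unfolding q_def by simp
    have "q \<noteq> 0" using False deg by (auto simp: q_def pcompose_eq_0_iff)
    then have "v (poly.coeff q (Polynomial.degree p)) \<noteq> Pinf"
      using deg U by (simp add: Pinf_iff flip: deg)
    moreover have "?M p \<le> v (poly.coeff q (Polynomial.degree p)) + Fin (nat_mult (Polynomial.degree p) \<gamma>)"
      unfolding q_def by (rule Min_le) auto
    ultimately have 1: "?M p \<noteq> Pinf"
      by (cases "v (poly.coeff q (Polynomial.degree p))") auto
    have "?M p \<in> (\<lambda>i. v (poly.coeff q i) + Fin (nat_mult i \<gamma>)) ` {..Polynomial.degree p}"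
      unfolding q_def by (rule Min_in) auto
    then obtain i where "?M p = v (poly.coeff q i) + Fin (nat_mult i \<gamma>)" by blast
    then have 2: "?M p \<noteq> Minf"
      using not_Minf[of "poly.coeff q i"] U by (cases "v (poly.coeff q i)") auto
    have 3: "w (to_fract p) \<noteq> Minf" "w (to_fract p) \<noteq> Pinf"
      using False w.not_Minf[of "to_fract p"] w.Pinf_iff[of "to_fract p"] by simp_all
    show ?thesis
    proof (rule antisym)
      show "w (to_fract p) \<le> ?M p" by (rule extended_le_iff_Fin) (use 1 2 3 iff in blast)+
      show "?M p \<le> w (to_fract p)" by (rule extended_le_iff_Fin) (use 1 2 3 iff in blast)+
    qed
  qed
  with R show ?L unfolding is_monomial_valuation_def ratfuns_UNIV by blast
qed

end

text \<open>The Taylor expansion of \<open>X - c\<close> at \<open>a\<close> is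
  \<open>(a - c) + (X - a)\<close>. Thus \<open>\<gamma>\<close> bounds the values of all
  \<open>X - c\<close>, and is reached exactly for \<open>c\<close> in the closed ball of radius
  \<open>\<gamma>\<close> about \<open>a\<close>.\<close>

lemma monomial_linear:
  assumes "is_monomial_valuation E v a \<gamma> w" "subfield E ambient" "c \<in> E" "v 1 = 0"
  shows "w (indet - const c) = min (v (a - c)) (Fin \<gamma>)"
proof -
  have "[:- c, 1:] \<in> polys_over E"
    using assms by (intro polys_over_pCons polys_over_0 subfield_uminus subfield_one)
  then have "w (to_fract [:- c, 1:]) = Min ((\<lambda>i. v (poly.coeff (pcompose [:- c, 1:] [:a, 1:]) i) +
      Fin (nat_mult i \<gamma>)) ` {..Polynomial.degree [:- c, 1:]})"
    using assms(1) by (simp add: is_monomial_valuation_def polys_over_def)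
  also have "pcompose [:- c, 1:] [:a, 1:] = [:a - c, 1:]" by (simp add: pcompose_pCons)
  also have "{..Polynomial.degree [:- c, 1:]} = {0, 1}" by auto
  finally show ?thesis
    using assms(4) by (simp add: to_fract_linear nat_mult_Suc flip: zero_extended_def)
qed


subsection \<open>Values of linear factors\<close>

lemma lex_embed_value_of_split:
  assumes W: "valued UNIV W" and u: "valued (ratfuns E) u"
    and A: "\<And>x. x \<in># A \<Longrightarrow> x \<in> E \<and> W (indet - const x) = lex_embed (u (indet - const x))"
  shows "to_fract (\<Prod>x\<in>#A. [:- x, 1:]) \<in> ratfuns E \<and>
    W (to_fract (\<Prod>x\<in>#A. [:- x, 1:])) = lex_embed (u (to_fract (\<Prod>x\<in>#A. [:- x, 1:])))"
  using A
proof (induction A)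
  case empty
  then show ?case using valued.one[OF W] valued.one[OF u] subfield_one[OF subfield_ratfuns]
    by (simp add: zero_extended_def zero_prod_def)
next
  case (add x A)
  have mem: "indet - const x \<in> ratfuns E"
    using add.prems[of x] by (intro subfield_diff subfield_ratfuns indet_ratfuns const_ratfuns) auto
  from add show ?case
    using mem valued.mult[OF W] valued.mult[OF u mem]
    by (auto simp: to_fract_linear lex_embed_add intro: subfield_mult subfield_ratfuns simp del: mult_pCons_left)
qed

text \<open>Polynomials over \<open>F\<close> split, with all roots in \<open>alg_cl F\<close>, so
  constants and linear factors decide everything.\<close>

lemma lex_embed_value_of_poly:
  fixes F :: "'a::alg_closed_field set"
  assumes W: "valued UNIV W" and u: "valued (ratfuns (alg_cl F)) u" and F: "subfield F ambient"
    and const: "\<And>c. c \<in> F \<Longrightarrow> W (const c) = lex_embed (u (const c))"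
    and lin: "\<And>c. c \<in> alg_cl F \<Longrightarrow> W (indet - const c) = lex_embed (u (indet - const c))"
    and p: "p \<in> polys_over F"
  shows "W (to_fract p) = lex_embed (u (to_fract p))"
proof (cases "p = 0")
  case True
  then show ?thesis by (simp add: valued.zero[OF W] valued.zero[OF u])
next
  case False
  obtain A where A: "p = smult (Polynomial.lead_coeff p) (\<Prod>x\<in>#A. [:- x, 1:])"
    "\<And>x. x \<in># A \<Longrightarrow> poly p x = 0"
    using polynomial_splits[OF False] by blast
  have "x \<in> alg_cl F" if "x \<in># A" for x
    using A(2)[OF that] p False by (auto simp: alg_cl_iff[OF F])
  then have s: "to_fract (\<Prod>x\<in>#A. [:- x, 1:]) \<in> ratfuns (alg_cl F)"
    "W (to_fract (\<Prod>x\<in>#A. [:- x, 1:])) = lex_embed (u (to_fract (\<Prod>x\<in>#A. [:- x, 1:])))"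
    using lex_embed_value_of_split[OF W u, of A] lin by auto
  let ?c = "Polynomial.lead_coeff p"
  have c: "?c \<in> F" using p by (simp add: polys_over_def)
  then have c': "const ?c \<in> ratfuns (alg_cl F)" using subset_alg_cl[OF F] by (auto intro: const_ratfuns)
  have eq: "to_fract p = const ?c * to_fract (\<Prod>x\<in>#A. [:- x, 1:])"
    by (subst A(1)) (rule to_fract_smult)
  show ?thesis
    unfolding eq valued.mult[OF u c' s(1)] valued.mult[OF W UNIV_I UNIV_I]
    by (simp add: lex_embed_add const c s(2))
qed


subsection \<open>The largest slope of a Newton polygon\<close>

lemma map_poly_const_mult: "map_poly const (p * q) = map_poly const p * map_poly const q"
proof (induction p)
  case (pCons a p)
  have 1: "map_poly const (smult a q) = smult (const a) (map_poly const q)" for a q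
    by (intro poly_eqI) simp
  have 2: "map_poly const (p + q) = map_poly const p + map_poly const q" for p q
    by (intro poly_eqI) simp
  show ?case using pCons by (simp add: map_poly_pCons 1 2)
qed simp

lemma map_poly_const_split:
  "map_poly const (\<Prod>x\<in>#A. [:- x, 1:]) = (\<Prod>x\<in>#A. [:- const x, 1:])"
  by (induction A) (simp_all add: map_poly_const_mult map_poly_pCons del: mult_pCons_left)

lemma pcompose_split:
  "pcompose (\<Prod>x\<in>#A. [:- const x, 1:]) [:indet, 1:] = (\<Prod>x\<in>#A. [:indet - const x, 1:])"
  by (induction A) (simp_all add: pcompose_mult pcompose_pCons pcompose_1 del: mult_pCons_left)

text \<open>\<open>h\<close> is the \<open>i\<close>-th Hasse derivative of \<open>p\<close>. The
  same \<open>h\<close> serves the generic point \<open>indet\<close>, for the Newton polygon, and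
  every constant \<open>a\<close>, for comparing Taylor expansions at different centres.\<close>

lemma taylor_coeffs:
  assumes F: "subfield F ambient" and p: "p \<in> polys_over F"
  shows "\<exists>h\<in>polys_over F. poly.coeff (pcompose (map_poly const p) [:indet, 1:]) i = to_fract h \<and>
    (\<forall>a. poly.coeff (pcompose p [:a, 1:]) i = poly h a)"
  using p
proof (induction p arbitrary: i)
  case 0
  then show ?case using polys_over_0[OF F] by (intro bexI[of _ 0]) auto
next
  case (pCons c p)
  then have c: "c \<in> F" and p: "p \<in> polys_over F"
    using coeff_polys_over[OF pCons.prems, of 0] coeff_polys_over[OF pCons.prems, of "Suc j" for j]
    by (auto simp: polys_over_def)
  obtain h where h: "h \<in> polys_over F" "poly.coeff (pcompose (map_poly const p) [:indet, 1:]) i = to_fract h"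
    "\<And>a. poly.coeff (pcompose p [:a, 1:]) i = poly h a"
    using pCons.IH[OF p, of i] by auto
  have ph: "pCons 0 h \<in> polys_over F" using h(1) F by (intro polys_over_pCons subfield_zero)
  show ?case
  proof (cases i)
    case 0
    then show ?thesis
      using h c F by (intro bexI[of _ "pCons c h"] polys_over_pCons)
        (auto simp: pcompose_pCons map_poly_pCons to_fract_pCons)
  next
    case (Suc j)
    obtain h' where h': "h' \<in> polys_over F" "poly.coeff (pcompose (map_poly const p) [:indet, 1:]) j = to_fract h'"
      "\<And>a. poly.coeff (pcompose p [:a, 1:]) j = poly h' a"
      using pCons.IH[OF p, of j] by auto
    show ?thesis
      using h h' Suc ph F by (intro bexI[of _ "pCons 0 h + h'"] polys_over_add)
        (auto simp: pcompose_pCons map_poly_pCons to_fract_pCons)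
  qed
qed

text \<open>For \<open>Y\<close> of value \<open>\<gamma>\<close>, the constant term dominates
  strictly in each factor \<open>(X - x) + Y\<close>, and products inherit this. In the language of
  Newton polygons: all slopes are below \<open>\<gamma>\<close>.\<close>

lemma dominant_constant_term:
  fixes W :: "'a::field poly fract \<Rightarrow> 'g::linordered_ab_group_add extended"
  assumes W: "valued UNIV W" and A: "\<And>x. x \<in># A \<Longrightarrow> W (indet - const x) < Fin \<gamma>"
  defines "P \<equiv> \<Prod>x\<in>#A. [:indet - const x, 1:]"
  shows "poly.coeff P 0 \<noteq> 0 \<and> (\<forall>j>0. W (poly.coeff P 0) < W (poly.coeff P j) + Fin (nat_mult j \<gamma>))"
  using A unfolding P_def
proof (induction A)
  case empty
  interpret valued UNIV W by fact
  show ?case by (simp add: one zero)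
next
  case (add x A)
  interpret valued UNIV W by fact
  define t where "t = indet - const x"
  define P where "P = (\<Prod>x\<in>#A. [:indet - const x, 1:])"
  have IH: "poly.coeff P 0 \<noteq> 0" "\<And>j. j > 0 \<Longrightarrow> W (poly.coeff P 0) < W (poly.coeff P j) + Fin (nat_mult j \<gamma>)"
    using add.IH add.prems unfolding P_def by simp_all
  have "t \<noteq> 0" using indet_neq_const[of x] by (auto simp: t_def)
  then obtain \<tau> where \<tau>: "W t = Fin \<tau>" "\<tau> < \<gamma>"
    using Fin[OF UNIV_I \<open>t \<noteq> 0\<close>] add.prems[of x]
    by (metis less_extended_simps(1) t_def union_single_eq_member)
  obtain \<pi> where \<pi>: "W (poly.coeff P 0) = Fin \<pi>" by (rule Fin[OF UNIV_I IH(1)])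
  have co: "poly.coeff ([:t, 1:] * P) j = t * poly.coeff P j + (if j = 0 then 0 else poly.coeff P (j - 1))" for j
    by (cases j) auto
  have "W (poly.coeff ([:t, 1:] * P) 0) < W (poly.coeff ([:t, 1:] * P) j) + Fin (nat_mult j \<gamma>)" if "j > 0" for j
  proof -
    obtain i where i: "j = Suc i" using \<open>j > 0\<close> gr0_conv_Suc by auto
    have "Fin (\<pi> - nat_mult j \<gamma>) < W (poly.coeff P j)"
      using IH(2)[OF that] unfolding \<pi> Fin_less_add_iff .
    then have "Fin \<tau> + Fin (\<pi> - nat_mult j \<gamma>) < Fin \<tau> + W (poly.coeff P j)"
      by (simp only: extended_add_less_cancel)
    then have "Fin (\<tau> + \<pi> - nat_mult j \<gamma>) < W (t * poly.coeff P j)"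
      using \<tau>(1) mult[of t "poly.coeff P j"] by (simp add: add_diff_eq)
    \<comment> \<open>This is the contribution of \<open>Y * P\<close>. Strictness has to come from
      \<open>\<tau> < \<gamma>\<close>, because for \<open>i = 0\<close> the induction hypothesis
      says nothing and only equality is available.\<close>
    moreover have "Fin (\<tau> + \<pi> - nat_mult j \<gamma>) < W (poly.coeff P i)"
    proof -
      have "Fin \<pi> \<le> W (poly.coeff P i) + Fin (nat_mult i \<gamma>)"
        using IH(2)[of i] \<pi> by (cases "i = 0") (auto intro: less_imp_le)
      then have "Fin (\<pi> - nat_mult i \<gamma>) \<le> W (poly.coeff P i)" unfolding Fin_le_add_iff .
      moreover have "\<tau> + (\<pi> - nat_mult j \<gamma>) < \<gamma> + (\<pi> - nat_mult j \<gamma>)"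
        using \<tau>(2) by (rule add_strict_right_mono)
      then have "\<tau> + \<pi> - nat_mult j \<gamma> < \<pi> - nat_mult i \<gamma>"
        by (simp add: i nat_mult_Suc add_diff_eq)
      then have "Fin (\<tau> + \<pi> - nat_mult j \<gamma>) < Fin (\<pi> - nat_mult i \<gamma>)" by simp
      ultimately show ?thesis by (rule order.strict_trans2[rotated])
    qed
    ultimately have "Fin (\<tau> + \<pi> - nat_mult j \<gamma>) < min (W (t * poly.coeff P j)) (W (poly.coeff P i))" by simp
    also have "\<dots> \<le> W (poly.coeff ([:t, 1:] * P) j)" unfolding co using i add_ge by simp
    finally have "Fin (\<tau> + \<pi>) < W (poly.coeff ([:t, 1:] * P) j) + Fin (nat_mult j \<gamma>)"
      unfolding Fin_less_add_iff .
    moreover have "W (poly.coeff ([:t, 1:] * P) 0) = Fin (\<tau> + \<pi>)"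
      unfolding co using \<tau>(1) \<pi> mult[of t "poly.coeff P 0"] by simp
    ultimately show ?thesis by simp
  qed
  moreover have "poly.coeff ([:t, 1:] * P) 0 \<noteq> 0"
    unfolding co using IH(1) \<open>t \<noteq> 0\<close> by simp
  moreover have "(\<Prod>x\<in>#add_mset x A. [:indet - const x, 1:]) = [:t, 1:] * P"
    unfolding t_def P_def by (simp del: mult_pCons_left)
  ultimately show ?case by metis
qed

text \<open>
  Taylor expansion of \<open>p\<close> at \<open>X\<close> turns the values of the differences \<open>X - d\<close>, for the roots \<open>d\<close> of
  \<open>p\<close>, into the slopes of the Newton polygon of a polynomial with coefficients in \<open>F[X]\<close>.
\<close>

lemma max_slope:
  fixes F :: "'a::alg_closed_field set"
  assumes W: "valued UNIV W" and W1: "valued UNIV W1" and F: "subfield F ambient"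
    and eq: "\<And>q. q \<in> polys_over F \<Longrightarrow> W (to_fract q) = W1 (to_fract q)"
    and p: "p \<in> polys_over F" "p \<noteq> 0" "poly p c = 0"
  shows "\<exists>d. poly p d = 0 \<and> W (indet - const c) \<le> W1 (indet - const d)"
proof (rule ccontr)
  interpret W: valued UNIV W by fact
  interpret W1: valued UNIV W1 by fact
  assume neg: "\<not> ?thesis"
  have less: "W1 (indet - const d) < W (indet - const c)" if "poly p d = 0" for d
    using that neg by (meson not_le)
  obtain \<gamma> where \<gamma>: "W (indet - const c) = Fin \<gamma>"
    using W.Fin[of "indet - const c"] indet_neq_const[of c] by auto
  obtain A where A: "p = smult (Polynomial.lead_coeff p) (\<Prod>x\<in>#A. [:- x, 1:])"
    "\<And>x. x \<in># A \<Longrightarrow> poly p x = 0"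
    using polynomial_splits[OF p(2)] by blast
  define l where "l = const (Polynomial.lead_coeff p)"
  define Q where "Q = (\<Prod>x\<in>#A. [:indet - const x, 1:])"
  define P where "P = pcompose (map_poly const p) [:indet, 1:]"
  have "map_poly const p = map_poly const ([:Polynomial.lead_coeff p:] * (\<Prod>x\<in>#A. [:- x, 1:]))"
    by (subst A(1)) simp
  then have PQ: "P = smult l Q"
    unfolding P_def Q_def l_def map_poly_const_mult map_poly_const_split
    by (simp add: map_poly_pCons pcompose_smult pcompose_split)
  have l: "l \<noteq> 0" using p(2) by (simp add: l_def)
  then obtain \<kappa> where \<kappa>: "W1 l = Fin \<kappa>" using W1.Fin by auto
  have Q: "poly.coeff Q 0 \<noteq> 0" "\<And>j. j > 0 \<Longrightarrow> W1 (poly.coeff Q 0) < W1 (poly.coeff Q j) + Fin (nat_mult j \<gamma>)"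
    using dominant_constant_term[OF W1, of A \<gamma>] less A(2) \<gamma> by (auto simp: Q_def)
  \<comment> \<open>The coefficients of \<open>P\<close> are polynomials in \<open>X\<close> over
    \<open>F\<close>, where the two valuations agree; so dominance, established for
    \<open>W1\<close>, passes to \<open>W\<close>.\<close>
  have dom: "W (poly.coeff P 0) < W (poly.coeff P j) + Fin (nat_mult j \<gamma>)" if "j > 0" for j
  proof -
    have "W (poly.coeff P i) = W1 (poly.coeff P i)" for i
      using taylor_coeffs[OF F p(1), of i] eq by (auto simp: P_def)
    moreover have "W1 (poly.coeff P 0) < W1 (poly.coeff P j) + Fin (nat_mult j \<gamma>)"
      using Q(2)[OF that] by (simp add: PQ W1.mult \<kappa> add.assoc)
    ultimately show ?thesis by simp
  qed
  \<comment> \<open>At \<open>Y = c - X\<close>, of value \<open>\<gamma>\<close> under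
    \<open>W\<close>, the polynomial \<open>P\<close> becomes \<open>p(c) = 0\<close>, although its
    constant term dominates there.\<close>
  let ?t = "- (indet - const c)"
  have "W ?t = Fin \<gamma>" using \<gamma> W.uminus[of "indet - const c"] by simp
  then have "W (poly.coeff P j * ?t ^ j) = W (poly.coeff P j) + Fin (nat_mult j \<gamma>)" for j
    using W.power[of ?t \<gamma> j] by (simp add: W.mult)
  then have "W (\<Sum>j\<le>Polynomial.degree P. poly.coeff P j * ?t ^ j) = W (poly.coeff P 0 * ?t ^ 0)"
    using dom Q(1) l by (intro W.sum_dominant) (auto simp: PQ zero_extended_def[symmetric])
  moreover have "poly P ?t = const (poly p c)"
    by (simp add: P_def poly_pcompose const_poly)
  ultimately have "W (poly.coeff P 0) = Pinf"
    using p(3) by (simp add: poly_altdef W.zero)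
  then show False using W.Pinf_iff[of "poly.coeff P 0"] Q(1) l by (simp add: PQ)
qed


subsection \<open>Extensions to the rational function field\<close>

locale ext_valued = V: valued UNIV V + W: valued UNIV W
  for V :: "'a::field \<Rightarrow> 'g::linordered_ab_group_add extended" and W :: "'a poly fract \<Rightarrow> 'g extended" +
  assumes const: "W (const c) = V c"
begin

lemma indet_Fin: obtains \<xi> where "W indet = Fin \<xi>"
  using W.Fin[of indet] indet_neq_const[of 0] by auto

lemma to_fract_gt:
  assumes p: "\<And>i. Fin \<mu> < V (poly.coeff p i) + Fin (nat_mult i \<xi>)" and X: "Fin \<xi> \<le> W indet"
  shows "Fin \<mu> < W (to_fract p)"
proof -
  have "Fin \<mu> < W (const (poly.coeff p i) * indet ^ i)" for i
  proof -
    have "Fin \<mu> < V (poly.coeff p i) + Fin (nat_mult i \<xi>)" by (rule p)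
    also have "\<dots> \<le> V (poly.coeff p i) + W (indet ^ i)"
      by (intro add_left_mono W.power_ge X) simp
    finally show ?thesis by (simp add: W.mult const)
  qed
  then have "Fin \<mu> < W (\<Sum>i\<le>Polynomial.degree (map_poly const p). const (poly.coeff p i) * indet ^ i)"
    by (intro W.sum_gt) simp
  then show ?thesis by (simp add: to_fract_eq_poly poly_altdef)
qed

end

context valued
begin

lemma poly_gt:
  assumes U: "F = UNIV" and p: "\<And>i. Fin \<mu> < v (poly.coeff p i) + Fin (nat_mult i \<alpha>)" and a: "Fin \<alpha> \<le> v a"
  shows "Fin \<mu> < v (poly p a)"
proof -
  have "Fin \<mu> < v (poly.coeff p i * a ^ i)" for i
  proof -
    have "Fin \<mu> < v (poly.coeff p i) + Fin (nat_mult i \<alpha>)" by (rule p)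
    also have "\<dots> \<le> v (poly.coeff p i) + v (a ^ i)"
      by (intro add_left_mono power_ge a) (simp add: U)
    finally show ?thesis by (simp add: mult U)
  qed
  then show ?thesis unfolding poly_altdef by (intro sum_gt) (simp add: U)
qed

end


subsection \<open>Dense subfields\<close>

locale dense_subfield = V: valued UNIV V
  for V :: "'a::alg_closed_field \<Rightarrow> 'g::linordered_ab_group_add extended" +
  fixes K Kh :: "'a set"
  assumes K: "subfield K ambient" and Kh: "subfield Kh ambient" and K_Kh: "K \<subseteq> Kh"
    and dense: "dense_in K Kh V" and closure: "alg_cl Kh = UNIV"
begin

abbreviation \<Gamma> :: "'g set" where "\<Gamma> \<equiv> value_group V K"

sublocale K: valued K V
  using K V.valuation by (intro valued.intro) (simp_all add: valuation_on_def)

sublocale Kh: valued Kh V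
  using Kh V.valuation by (intro valued.intro) (simp_all add: valuation_on_def)

text \<open>An element of \<open>K\<close> that is closer to \<open>x\<close> than the value of
  \<open>x\<close> has the same value as \<open>x\<close>.\<close>

lemma value_group_eq: "value_group V Kh = \<Gamma>"
proof
  show "\<Gamma> \<subseteq> value_group V Kh" using K_Kh by (auto simp: value_group_def)
  show "value_group V Kh \<subseteq> \<Gamma>"
  proof
    fix \<alpha> assume \<alpha>: "\<alpha> \<in> value_group V Kh"
    then obtain x where x: "x \<in> Kh" "V x = Fin \<alpha>" by (auto simp: value_group_def)
    then obtain b where "b \<in> K" "V x < V (x - b)"
      using dense \<alpha> unfolding dense_in_def by metis
    then show "\<alpha> \<in> \<Gamma>" using x V.eq_of_diff[of x b] by (intro K.value_groupI[of b]) auto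
  qed
qed

lemma torsion:
  assumes "V c = Fin \<gamma>"
  shows "\<exists>m>0. nat_mult m \<gamma> \<in> \<Gamma>"
proof -
  have "c \<in> alg_cl Kh" using closure by simp
  then obtain p where "p \<in> polys_over Kh" "p \<noteq> 0" "poly p c = 0"
    by (auto simp: alg_cl_iff[OF Kh])
  then show ?thesis
    using V.torsion_value[OF Kh _ _ _ _ _ assms] by (simp add: value_group_eq)
qed

text \<open>Cofinality of \<open>\<Gamma>\<close>: a positive multiple of the value lies in
  \<open>\<Gamma>\<close> and bounds it if it is nonnegative; the maximum with 0 covers negative
  values.\<close>

lemma value_le: assumes "c \<noteq> 0" obtains \<beta> where "\<beta> \<in> \<Gamma>" "V c \<le> Fin \<beta>"
proof -
  obtain \<gamma> where \<gamma>: "V c = Fin \<gamma>" using V.Fin assms by auto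
  then obtain m where m: "m > 0" "nat_mult m \<gamma> \<in> \<Gamma>" using torsion by blast
  define \<beta> where "\<beta> = max 0 (nat_mult m \<gamma>)"
  have "\<beta> \<in> \<Gamma>" using m K.value_group_zero by (simp add: \<beta>_def max_def)
  moreover have "\<gamma> \<le> \<beta>"
  proof (cases "0 \<le> \<gamma>")
    case True
    then show ?thesis using m by (intro nat_mult_le_self[of \<gamma> m]) (auto simp: \<beta>_def)
  next
    case False
    then show ?thesis by (simp add: \<beta>_def le_max_iff_disj less_imp_le)
  qed
  ultimately show ?thesis using that \<gamma> by simp
qed

lemma value_ge: obtains \<beta> where "\<beta> \<in> \<Gamma>" "Fin \<beta> \<le> V c"
proof (cases "c = 0")
  case True
  then show ?thesis using that K.value_group_zero V.zero by simp
next
  case False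
  then obtain \<gamma> where \<gamma>: "V c = Fin \<gamma>" using V.Fin by auto
  obtain \<beta> where "\<beta> \<in> \<Gamma>" "V (inverse c) \<le> Fin \<beta>" using value_le[of "inverse c"] False by auto
  then show ?thesis
    using that[of "- \<beta>"] V.inverse[OF _ \<gamma>] \<gamma> K.value_group_uminus by (simp add: minus_le_iff)
qed

lemma \<Gamma>_max: "\<alpha> \<in> \<Gamma> \<Longrightarrow> \<beta> \<in> \<Gamma> \<Longrightarrow> max \<alpha> \<beta> \<in> \<Gamma>"
  by (simp add: max_def)

lemma \<Gamma>_min: "\<alpha> \<in> \<Gamma> \<Longrightarrow> \<beta> \<in> \<Gamma> \<Longrightarrow> min \<alpha> \<beta> \<in> \<Gamma>"
  by (simp add: min_def)

text \<open>Zero coefficients are approximated by 0 exactly. This makes \<open>g\<close> a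
  polynomial, and it allows bounds \<open>\<beta> i\<close> that are meaningful only where the
  coefficient has a finite value.\<close>

lemma approx:
  assumes p: "p \<in> polys_over Kh" and \<beta>: "\<And>i. \<beta> i \<in> \<Gamma>"
  obtains g where "g \<in> polys_over K" "\<And>i. poly.coeff p i = 0 \<Longrightarrow> poly.coeff (p - g) i = 0"
    "\<And>i. Fin (\<beta> i) < V (poly.coeff (p - g) i)"
proof -
  have "\<exists>b\<in>K. Fin (\<beta> i) < V (poly.coeff p i - b) \<and> (poly.coeff p i = 0 \<longrightarrow> b = 0)" for i
  proof (cases "poly.coeff p i = 0")
    case True
    then show ?thesis using V.zero by (intro bexI[of _ 0]) simp_all
  next
    case False
    then show ?thesis
      using dense \<beta>[of i] coeff_polys_over[OF p, of i] unfolding dense_in_def value_group_eq by auto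
  qed
  then obtain b where b: "\<And>i. b i \<in> K" "\<And>i. Fin (\<beta> i) < V (poly.coeff p i - b i)"
    "\<And>i. poly.coeff p i = 0 \<Longrightarrow> b i = 0" by metis
  define g where "g = Poly (map b [0..<Suc (Polynomial.degree p)])"
  have g: "poly.coeff g i = b i" for i
  proof (cases "i \<le> Polynomial.degree p")
    case True
    then show ?thesis by (simp add: g_def nth_default_def del: upt_Suc)
  next
    case False
    then have "b i = 0" using b(3) by (simp add: coeff_eq_0)
    then show ?thesis using False by (simp add: g_def nth_default_def del: upt_Suc)
  qed
  show ?thesis using that[of g] b g by (simp add: polys_over_def)
qed

end

locale dense_ext = dense_subfield V K Kh + ext_valued V W
  for V :: "'a::alg_closed_field \<Rightarrow> 'g::linordered_ab_group_add extended" and K Kh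
    and W :: "'a poly fract \<Rightarrow> 'g extended"
begin

lemma to_fract_ge:
  assumes X: "\<xi> \<in> \<Gamma>" "Fin \<xi> \<le> W indet"
  shows "\<exists>\<beta>\<in>\<Gamma>. Fin \<beta> \<le> W (to_fract p)"
proof (induction p)
  case 0
  then show ?case using K.value_group_zero W.zero by auto
next
  case (pCons c p)
  then obtain \<beta> where \<beta>: "\<beta> \<in> \<Gamma>" "Fin \<beta> \<le> W (to_fract p)" by auto
  obtain \<alpha> where \<alpha>: "\<alpha> \<in> \<Gamma>" "Fin \<alpha> \<le> V c" by (rule value_ge)
  have "Fin (\<xi> + \<beta>) \<le> W (indet * to_fract p)"
    using add_mono[OF X(2) \<beta>(2)] by (simp add: W.mult)
  then have "Fin (min \<alpha> (\<xi> + \<beta>)) \<le> min (W (const c)) (W (indet * to_fract p))"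
    using \<alpha>(2) by (auto simp: const simp flip: min_extended_simps intro: min.coboundedI1 min.coboundedI2)
  also have "\<dots> \<le> W (to_fract (pCons c p))" unfolding to_fract_pCons by (rule W.add_ge) simp_all
  finally show ?case using \<Gamma>_min[OF \<alpha>(1) K.value_group_add[OF X(1) \<beta>(1)]] by auto
qed

lemma monomial_iff:
  assumes "is_monomial_valuation UNIV V a \<gamma> W"
  shows "Fin \<mu> \<le> W (to_fract p) \<longleftrightarrow> gauss_le V \<gamma> \<mu> (pcompose p [:a, 1:])"
  using assms by (simp add: V.is_monomial_valuation_iff)

lemma monomial_indet_const:
  assumes "is_monomial_valuation UNIV V a \<gamma> W"
  shows "W (indet - const c) = min (V (a - c)) (Fin \<gamma>)"
  using monomial_linear[OF assms subfield_UNIV] V.one by simp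

lemma monomial_indet:
  assumes "is_monomial_valuation UNIV V a \<gamma> W"
  shows "W indet = min (V a) (Fin \<gamma>)"
  using monomial_indet_const[OF assms, of 0] by simp

text \<open>The difference is divisible by \<open>X - a\<close>, whose value \<open>\<gamma>\<close>
  lies beyond \<open>\<Gamma>\<close>, while the value of the cofactor is bounded below in
  \<open>\<Gamma>\<close>. So \<open>W\<close> cannot tell \<open>p\<close> from \<open>p(a)\<close>
  up to errors larger than every value of \<open>K\<close>.\<close>

lemma infinite_slope:
  assumes m: "is_monomial_valuation UNIV V a \<gamma> W" and \<gamma>: "\<And>\<beta>. \<beta> \<in> \<Gamma> \<Longrightarrow> \<beta> < \<gamma>" and \<delta>: "\<delta> \<in> \<Gamma>"
  shows "Fin \<delta> < W (to_fract p - const (poly p a))"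
proof -
  have "poly (p - [:poly p a:]) a = 0" by simp
  then obtain h where h: "p - [:poly p a:] = [:- a, 1:] * h"
    unfolding poly_eq_0_iff_dvd by (elim dvdE)
  have "to_fract p - const (poly p a) = to_fract (p - [:poly p a:])"
    by (simp add: const_def)
  also have "\<dots> = (indet - const a) * to_fract h" unfolding h to_fract_mult to_fract_linear ..
  finally have eq: "W (to_fract p - const (poly p a)) = W (indet - const a) + W (to_fract h)"
    by (simp add: W.mult)
  have g: "W (indet - const a) = Fin \<gamma>" using monomial_indet_const[OF m, of a] V.zero by simp
  obtain \<alpha> where \<alpha>: "\<alpha> \<in> \<Gamma>" "Fin \<alpha> \<le> V a" by (rule value_ge)
  have "Fin (min 0 \<alpha>) \<le> W indet"
    using \<alpha>(2) \<gamma>[OF K.value_group_zero] unfolding monomial_indet[OF m]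
    by (cases "V a") (auto simp: min_le_iff_disj)
  then obtain \<beta> where \<beta>: "\<beta> \<in> \<Gamma>" "Fin \<beta> \<le> W (to_fract h)"
    using to_fract_ge[OF \<Gamma>_min[OF K.value_group_zero \<alpha>(1)], of h] by auto
  have "\<delta> - \<beta> < \<gamma>" by (intro \<gamma> K.value_group_diff \<delta> \<beta>)
  then have "Fin (\<delta> - \<beta>) + Fin \<beta> < Fin \<gamma> + W (to_fract h)"
    by (intro extended_add_less_le \<beta>) simp
  then show ?thesis unfolding eq g by simp
qed

text \<open>Bounds the cancellation between the coefficients of \<open>p\<close> at 0. Lowering the
  slope from \<open>\<gamma>\<close> to \<open>\<xi> = min (V a) \<gamma>\<close> costs at most
  \<open>n\<close> times the drop, \<open>n\<close> being the degree; moving the centre from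
  \<open>a\<close> to 0 at slope \<open>\<xi>\<close> then costs nothing because
  \<open>\<xi>\<close> is at most \<open>V a\<close>.\<close>

lemma slope_loss:
  assumes m: "is_monomial_valuation UNIV V a \<gamma> W" and \<gamma>: "\<gamma> \<le> \<beta>" "\<beta> \<in> \<Gamma>"
    and \<mu>: "W (to_fract p) = Fin \<mu>" and \<xi>: "W indet = Fin \<xi>"
  shows "\<exists>\<eta>\<in>\<Gamma>. gauss_le V \<xi> (\<mu> - \<eta>) p"
proof -
  have mn: "min (V a) (Fin \<gamma>) = Fin \<xi>" using \<xi> monomial_indet[OF m] by simp
  have xa: "Fin \<xi> \<le> V a" and xg: "\<xi> \<le> \<gamma>" using mn by (auto simp: min_def split: if_splits)
  \<comment> \<open>If the slope drops at all, then \<open>\<xi>\<close> is the value of the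
    constant \<open>a\<close> and so is bounded below in \<open>\<Gamma>\<close>, as
    \<open>\<gamma>\<close> is bounded above.\<close>
  have "\<exists>\<eta>\<in>\<Gamma>. 0 \<le> \<eta> \<and> \<gamma> - \<xi> \<le> \<eta>"
  proof (cases "\<xi> = \<gamma>")
    case True
    then show ?thesis using K.value_group_zero by auto
  next
    case False
    then have "V a = Fin \<xi>" using mn by (auto simp: min_def split: if_splits)
    then obtain \<alpha> where \<alpha>: "\<alpha> \<in> \<Gamma>" "\<alpha> \<le> \<xi>" using value_ge[of a] by auto
    have "\<gamma> - \<xi> \<le> \<beta> - \<alpha>" using \<gamma>(1) \<alpha>(2) by (rule diff_mono)
    moreover have "0 \<le> \<beta> - \<alpha>" using calculation xg by (metis diff_ge_0_iff_ge order_trans)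
    ultimately show ?thesis using K.value_group_diff[OF \<gamma>(2) \<alpha>(1)] by blast
  qed
  then obtain \<eta> where \<eta>: "\<eta> \<in> \<Gamma>" "0 \<le> \<eta>" "\<gamma> - \<xi> \<le> \<eta>" by auto
  define n where "n = Polynomial.degree p"
  define q where "q = pcompose p [:a, 1:]"
  have q: "gauss_le V \<gamma> \<mu> q" using monomial_iff[OF m, of \<mu> p] \<mu> by (simp add: q_def)
  have "gauss_le V \<xi> (\<mu> - nat_mult n \<eta>) q"
    unfolding gauss_le_def Fin_le_add_iff
  proof
    fix i
    show "Fin (\<mu> - nat_mult n \<eta> - nat_mult i \<xi>) \<le> V (poly.coeff q i)"
    proof (cases "i \<le> n")
      case True
      have "nat_mult i \<gamma> - nat_mult i \<xi> \<le> nat_mult i \<eta>"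
        using nat_mult_mono[OF \<eta>(3), of i] by (simp add: nat_mult_diff)
      also have "\<dots> \<le> nat_mult n \<eta>" using True \<eta>(2) by (rule nat_mult_mono_left)
      finally have "\<mu> - nat_mult n \<eta> - nat_mult i \<xi> \<le> \<mu> - nat_mult i \<gamma>"
        by (simp add: algebra_simps)
      then have "Fin (\<mu> - nat_mult n \<eta> - nat_mult i \<xi>) \<le> Fin (\<mu> - nat_mult i \<gamma>)" by simp
      also have "\<dots> \<le> V (poly.coeff q i)" using q unfolding gauss_le_def Fin_le_add_iff by blast
      finally show ?thesis .
    next
      case False
      then have "poly.coeff q i = 0" by (intro coeff_eq_0) (simp add: q_def n_def degree_pcompose)
      then show ?thesis by (simp add: V.zero)
    qed
  qed
  then have "gauss_le V \<xi> (\<mu> - nat_mult n \<eta>) (pcompose q [:- a, 1:])"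
    using xa V.uminus[of a] by (intro V.gauss_le_shift) simp_all
  also have "pcompose q [:- a, 1:] = p"
    by (simp add: q_def pcompose_pCons flip: pcompose_assoc)
  finally show ?thesis using K.value_group_nat_mult[OF \<eta>(1)] by auto
qed

end

section \<open>Two extensions that agree on the polynomials over \<open>K\<close>\<close>

locale dense_ext2 = dense_ext V K Kh W + W1: dense_ext V K Kh W1
  for V :: "'a::alg_closed_field \<Rightarrow> 'g::linordered_ab_group_add extended" and K Kh
    and W W1 :: "'a poly fract \<Rightarrow> 'g extended" +
  assumes eq_K: "p \<in> polys_over K \<Longrightarrow> W (to_fract p) = W1 (to_fract p)"
begin

lemma swap: "dense_ext2 V K Kh W1 W"
  using eq_K by unfold_locales simp

lemma eq_indet: "W indet = W1 indet"
  unfolding indet_def by (intro eq_K polys_over_pCons polys_over_0 K subfield_zero subfield_one)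

text \<open>Both valuations reduce \<open>g\<close> to its value at the respective centre, and they
  agree on \<open>g\<close>. If \<open>g\<close> vanished at \<open>a1\<close> only, its value would
  lie above \<open>\<Gamma>\<close> for \<open>W1\<close> but be bounded in \<open>\<Gamma>\<close>
  for \<open>W\<close>.\<close>

lemma eval_le:
  assumes m: "is_monomial_valuation UNIV V a \<gamma> W" "is_monomial_valuation UNIV V a1 \<gamma> W1"
    and \<gamma>: "\<And>\<beta>. \<beta> \<in> \<Gamma> \<Longrightarrow> \<beta> < \<gamma>" and g: "g \<in> polys_over K"
  shows "V (poly g a1) \<le> V (poly g a)"
proof (cases "poly g a1 = 0")
  case False
  then obtain \<delta> where \<delta>: "\<delta> \<in> \<Gamma>" "V (poly g a1) \<le> Fin \<delta>" by (rule value_le)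
  have "Fin \<delta> < W1 (to_fract g - const (poly g a1))" by (rule W1.infinite_slope[OF m(2) \<gamma> \<delta>(1)])
  then have "W1 (to_fract g) = V (poly g a1)"
    using \<delta>(2) W1.W.eq_of_diff[of "const (poly g a1)" "to_fract g"] W1.W.minus_commute[of "to_fract g"]
    by (simp add: W1.const)
  then have "W (to_fract g) = V (poly g a1)" using eq_K[OF g] by simp
  moreover have "Fin \<delta> < W (to_fract g - const (poly g a))" by (rule infinite_slope[OF m(1) \<gamma> \<delta>(1)])
  ultimately have "V (poly g a) = V (poly g a1)"
    using \<delta>(2) W.eq_of_diff[of "to_fract g" "const (poly g a)"] by (simp add: const)
  then show ?thesis by simp
next
  case True
  show ?thesis
  proof (rule ccontr)
    assume neg: "\<not> ?thesis"
    then have "poly g a \<noteq> 0" using True by (auto simp: V.zero)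
    then obtain \<delta> where \<delta>: "\<delta> \<in> \<Gamma>" "V (poly g a) \<le> Fin \<delta>" by (rule value_le)
    have "Fin \<delta> < W (to_fract g - const (poly g a))" by (rule infinite_slope[OF m(1) \<gamma> \<delta>(1)])
    then have "W (to_fract g) = V (poly g a)"
      using \<delta>(2) W.eq_of_diff[of "const (poly g a)" "to_fract g"] W.minus_commute[of "to_fract g"]
      by (simp add: const)
    moreover have "Fin \<delta> < W1 (to_fract g - const (poly g a1))" by (rule W1.infinite_slope[OF m(2) \<gamma> \<delta>(1)])
    ultimately show False using \<delta>(2) True eq_K[OF g] by simp
  qed
qed

text \<open>Approximating \<open>g\<close> over \<open>K\<close> closely enough at both centres at
  once would carry a violation of the inequality over to a polynomial over \<open>K\<close>.\<close>

lemma eval_le':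
  assumes m: "is_monomial_valuation UNIV V a \<gamma> W" "is_monomial_valuation UNIV V a1 \<gamma> W1"
    and \<gamma>: "\<And>\<beta>. \<beta> \<in> \<Gamma> \<Longrightarrow> \<beta> < \<gamma>" and g: "g \<in> polys_over Kh"
  shows "V (poly g a1) \<le> V (poly g a)"
proof (rule ccontr)
  assume neg: "\<not> ?thesis"
  then have "poly g a \<noteq> 0" by (auto simp: V.zero)
  then obtain \<delta> where \<delta>: "\<delta> \<in> \<Gamma>" "V (poly g a) \<le> Fin \<delta>" by (rule value_le)
  obtain \<alpha> where \<alpha>: "\<alpha> \<in> \<Gamma>" "Fin \<alpha> \<le> V a" by (rule value_ge)
  obtain \<alpha>1 where \<alpha>1: "\<alpha>1 \<in> \<Gamma>" "Fin \<alpha>1 \<le> V a1" by (rule value_ge)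
  \<comment> \<open>With \<open>\<alpha>\<close> and \<open>\<alpha>1\<close> below the values of
    \<open>a\<close> and \<open>a1\<close>, these bounds make every term of the error exceed
    \<open>\<delta>\<close> at both centres, and \<open>\<delta>\<close> bounds the smaller of the
    two values being compared.\<close>
  define \<beta> where "\<beta> i = max (\<delta> - nat_mult i \<alpha>) (\<delta> - nat_mult i \<alpha>1)" for i
  have "\<beta> i \<in> \<Gamma>" for i
    unfolding \<beta>_def by (intro \<Gamma>_max K.value_group_diff K.value_group_nat_mult \<delta> \<alpha> \<alpha>1)
  then obtain h where h: "h \<in> polys_over K" "\<And>i. Fin (\<beta> i) < V (poly.coeff (g - h) i)"
    using approx[OF g] by metis
  have b: "Fin (\<delta> - nat_mult i \<alpha>) < V (poly.coeff (g - h) i)"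
    "Fin (\<delta> - nat_mult i \<alpha>1) < V (poly.coeff (g - h) i)" for i
    by (rule order.strict_trans1[OF _ h(2)], simp add: \<beta>_def)+
  have "Fin \<delta> < V (poly (g - h) a)" "Fin \<delta> < V (poly (g - h) a1)"
    by (rule V.poly_gt[OF refl _ \<alpha>(2)], simp only: Fin_less_add_iff b)
       (rule V.poly_gt[OF refl _ \<alpha>1(2)], simp only: Fin_less_add_iff b)
  then have d: "Fin \<delta> < V (poly g a - poly h a)" "Fin \<delta> < V (poly g a1 - poly h a1)" by simp_all
  have 1: "V (poly h a) = V (poly g a)" using d(1) \<delta>(2) by (intro V.eq_of_diff) simp_all
  have "V (poly g a) < min (V (poly g a1)) (V (poly g a1 - poly h a1))"
    using neg order.strict_trans1[OF \<delta>(2) d(2)] by (simp add: not_le)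
  also have "\<dots> \<le> V (poly h a1)" using V.diff_ge[of "poly g a1" "poly g a1 - poly h a1"] by simp
  finally show False using eval_le[OF m \<gamma> h(1)] 1 by simp
qed

end

section \<open>Agreement on the rational functions over \<open>Kh\<close>\<close>

context dense_ext2
begin

interpretation S: dense_ext2 V K Kh W1 W by (rule swap)

lemma eq_Kh:
  assumes m: "is_monomial_valuation UNIV V a \<gamma> W" "is_monomial_valuation UNIV V a1 \<gamma> W1"
    and p: "p \<in> polys_over Kh"
  shows "W (to_fract p) = W1 (to_fract p)"
proof (cases "p = 0")
  case True
  then show ?thesis by (simp add: W.zero W1.W.zero)
next
  case p0: False
  have "to_fract p \<noteq> 0" using p0 by simp
  obtain \<mu> where \<mu>: "W (to_fract p) = Fin \<mu>" by (rule W.Fin[OF UNIV_I \<open>to_fract p \<noteq> 0\<close>])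
  obtain \<mu>1 where \<mu>1: "W1 (to_fract p) = Fin \<mu>1" by (rule W1.W.Fin[OF UNIV_I \<open>to_fract p \<noteq> 0\<close>])
  show ?thesis
  proof (cases "\<exists>\<beta>\<in>\<Gamma>. \<gamma> \<le> \<beta>")
    case True
    then obtain \<beta> where \<beta>: "\<gamma> \<le> \<beta>" "\<beta> \<in> \<Gamma>" by auto
    obtain \<xi> where \<xi>: "W indet = Fin \<xi>" by (rule indet_Fin)
    then have \<xi>1: "W1 indet = Fin \<xi>" by (simp add: eq_indet)
    obtain \<eta> where \<eta>: "\<eta> \<in> \<Gamma>" "gauss_le V \<xi> (\<mu> - \<eta>) p" using slope_loss[OF m(1) \<beta> \<mu> \<xi>] by auto
    obtain \<eta>1 where \<eta>1: "\<eta>1 \<in> \<Gamma>" "gauss_le V \<xi> (\<mu>1 - \<eta>1) p" using W1.slope_loss[OF m(2) \<beta> \<mu>1 \<xi>1] by auto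
    \<comment> \<open>The value of the coefficient plus the loss \<open>\<eta>\<close> is at least
      \<open>\<mu> - i \<xi>\<close>, and likewise with \<open>\<eta>1\<close> and
      \<open>\<mu>1\<close>; so one approximation works for both valuations. Unlike
      \<open>\<mu>\<close> and \<open>\<xi>\<close>, the values of coefficients in \<open>Kh\<close>
      are known to lie in \<open>\<Gamma>\<close>. The default 0 concerns zero coefficients, where
      there is no error.\<close>
    define \<beta>' where "\<beta>' i = (case V (poly.coeff p i) of Fin \<alpha> \<Rightarrow> \<alpha> + max \<eta> \<eta>1 | _ \<Rightarrow> 0)" for i
    have "\<beta>' i \<in> \<Gamma>" for i
    proof (cases "V (poly.coeff p i)")
      case (Fin \<alpha>)
      then have "\<alpha> \<in> \<Gamma>"
        using Kh.value_groupI[OF coeff_polys_over[OF p] Fin] value_group_eq by simp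
      then show ?thesis using Fin \<eta> \<eta>1 by (simp add: \<beta>'_def K.value_group_add \<Gamma>_max)
    qed (simp_all add: \<beta>'_def K.value_group_zero)
    then obtain g where g: "g \<in> polys_over K" "\<And>i. poly.coeff p i = 0 \<Longrightarrow> poly.coeff (p - g) i = 0"
      "\<And>i. Fin (\<beta>' i) < V (poly.coeff (p - g) i)"
      using approx[OF p] by metis
    have gt: "Fin \<nu> < V (poly.coeff (p - g) i) + Fin (nat_mult i \<xi>)"
      if \<nu>: "gauss_le V \<xi> (\<nu> - \<theta>) p" "\<theta> \<le> max \<eta> \<eta>1" for \<nu> \<theta> i
    proof (cases "poly.coeff p i = 0")
      case True
      then show ?thesis using g(2)[OF True] by (simp add: V.zero)
    next
      case False
      then obtain \<alpha> where \<alpha>: "V (poly.coeff p i) = Fin \<alpha>" using V.Fin by auto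
      have "\<nu> - \<theta> - nat_mult i \<xi> \<le> \<alpha>"
        using \<nu>(1) \<alpha> unfolding gauss_le_def Fin_le_add_iff by (metis less_eq_extended.simps(1))
      then have "(\<nu> - \<theta> - nat_mult i \<xi>) + \<theta> \<le> \<alpha> + max \<eta> \<eta>1" using \<nu>(2) by (rule add_mono)
      then have "\<nu> - nat_mult i \<xi> \<le> \<beta>' i" by (simp add: \<beta>'_def \<alpha> algebra_simps)
      then have "Fin (\<nu> - nat_mult i \<xi>) \<le> Fin (\<beta>' i)" by simp
      also have "\<dots> < V (poly.coeff (p - g) i)" by (rule g(3))
      finally show ?thesis unfolding Fin_less_add_iff .
    qed
    have "Fin \<mu> < W (to_fract (p - g))"
      by (rule to_fract_gt[OF gt[OF \<eta>(2)]]) (simp_all add: \<xi>)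
    then have "W (to_fract g) = Fin \<mu>" using W.eq_of_diff[of "to_fract p" "to_fract g"] \<mu> by simp
    moreover have "Fin \<mu>1 < W1 (to_fract (p - g))"
      by (rule W1.to_fract_gt[OF gt[OF \<eta>1(2)]]) (simp_all add: \<xi>1)
    then have "W1 (to_fract g) = Fin \<mu>1" using W1.W.eq_of_diff[of "to_fract p" "to_fract g"] \<mu>1 by simp
    ultimately show ?thesis using eq_K[OF g(1)] \<mu> \<mu>1 by simp
  next
    case False
    then have \<gamma>: "\<beta> < \<gamma>" if "\<beta> \<in> \<Gamma>" for \<beta> using that by (simp add: not_le)
    \<comment> \<open>Each Taylor coefficient is the value at the centre of one polynomial over
      \<open>Kh\<close>, the same for both centres. The values of these coefficients together with
      \<open>\<gamma>\<close> determine the value of \<open>p\<close>.\<close>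
    have "V (poly.coeff (pcompose p [:a, 1:]) i) = V (poly.coeff (pcompose p [:a1, 1:]) i)" for i
    proof -
      obtain h where "h \<in> polys_over Kh" "\<And>a. poly.coeff (pcompose p [:a, 1:]) i = poly h a"
        using taylor_coeffs[OF Kh p, of i] by auto
      then show ?thesis
        using eval_le'[OF m \<gamma>, of h] S.eval_le'[OF m(2,1) \<gamma>, of h] by simp
    qed
    then have "Fin \<nu> \<le> W (to_fract p) \<longleftrightarrow> Fin \<nu> \<le> W1 (to_fract p)" for \<nu>
      by (simp add: monomial_iff[OF m(1)] W1.monomial_iff[OF m(2)] gauss_le_def)
    then show ?thesis unfolding \<mu> \<mu>1 by (metis antisym less_eq_extended.simps(1) order_refl)
  qed
qed

lemma eq_ratfuns:
  assumes eq: "\<And>p. p \<in> polys_over Kh \<Longrightarrow> W (to_fract p) = W1 (to_fract p)" and x: "x \<in> ratfuns Kh"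
  shows "W x = W1 x"
proof -
  obtain p q where x: "x = to_fract p / to_fract q" and pq: "p \<in> polys_over Kh" "q \<in> polys_over Kh" "q \<noteq> 0"
    using x unfolding ratfuns_eq[OF Kh] by blast
  show ?thesis
  proof (cases "p = 0")
    case True
    then show ?thesis by (simp add: x W.zero W1.W.zero)
  next
    case False
    then have "to_fract p \<noteq> 0" "to_fract q \<noteq> 0" using pq(3) by simp_all
    then obtain \<alpha> \<beta> where ab: "W (to_fract p) = Fin \<alpha>" "W (to_fract q) = Fin \<beta>"
      by (metis W.Fin UNIV_I)
    then have "W1 (to_fract p) = Fin \<alpha>" "W1 (to_fract q) = Fin \<beta>"
      using eq[OF pq(1)] eq[OF pq(2)] by simp_all
    with ab show ?thesis
      using W.divide[OF UNIV_I UNIV_I ab] W1.W.divide[OF UNIV_I UNIV_I, of "to_fract p" \<alpha>] by (simp add: x)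
  qed
qed

end


subsection \<open>Minimal pairs\<close>

context dense_ext
begin

text \<open>The shift by an element of value at least \<open>\<gamma>\<close> and the inverse shift
  both preserve the bounds \<open>gauss_le\<close>, so every point of the closed ball about
  \<open>a\<close> serves as a centre.\<close>

lemma monomial_recenter:
  assumes m: "is_monomial_valuation UNIV V a \<gamma> W" and b: "Fin \<gamma> \<le> V (a - b)"
  shows "is_monomial_valuation UNIV V b \<gamma> W"
  unfolding V.is_monomial_valuation_iff[OF refl]
proof (intro conjI allI)
  show "valuation_on UNIV W" by (rule W.valuation)
  fix p \<mu>
  have 1: "pcompose (pcompose p [:a, 1:]) [:b - a, 1:] = pcompose p [:b, 1:]"
    and 2: "pcompose (pcompose p [:b, 1:]) [:a - b, 1:] = pcompose p [:a, 1:]"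
    by (simp_all add: pcompose_pCons flip: pcompose_assoc)
  have b': "Fin \<gamma> \<le> V (b - a)" using b V.minus_commute[of a b] by simp
  have "gauss_le V \<gamma> \<mu> (pcompose p [:a, 1:]) \<longleftrightarrow> gauss_le V \<gamma> \<mu> (pcompose p [:b, 1:])"
    using V.gauss_le_shift[OF refl b', of \<mu> "pcompose p [:a, 1:]"]
      V.gauss_le_shift[OF refl b, of \<mu> "pcompose p [:b, 1:]"] unfolding 1 2 by blast
  then show "Fin \<mu> \<le> W (to_fract p) \<longleftrightarrow> gauss_le V \<gamma> \<mu> (pcompose p [:b, 1:])"
    using monomial_iff[OF m] by blast
qed

lemma pair_of_definition_Kh:
  assumes m: "is_monomial_valuation UNIV V a \<gamma> W"
  shows "pair_of_definition Kh W a \<gamma>"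
proof -
  have "W (indet - const a) = Fin \<gamma>" using monomial_indet_const[OF m, of a] V.zero by simp
  then have "\<gamma> \<in> value_group W (ratfuns UNIV)"
    unfolding value_group_def ratfuns_UNIV by blast
  then show ?thesis using m unfolding pair_of_definition_def by (simp add: closure const)
qed

text \<open>By the ultrametric inequality the ball about \<open>b\<close> lies in the ball about
  \<open>a\<close>, so it suffices that \<open>b\<close> has least degree in the latter.\<close>

lemma minimal_pair_of_definition_Kh:
  assumes m: "is_monomial_valuation UNIV V a \<gamma> W" and b: "Fin \<gamma> \<le> V (a - b)"
    and min: "\<And>c. Fin \<gamma> \<le> V (a - c) \<Longrightarrow> simple_degree Kh b \<le> simple_degree Kh c"
  shows "minimal_pair_of_definition Kh W b \<gamma>"
  unfolding minimal_pair_of_definition_def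
proof (intro conjI ballI impI)
  show "pair_of_definition Kh W b \<gamma>" by (rule pair_of_definition_Kh[OF monomial_recenter[OF m b]])
  fix c assume "Fin \<gamma> \<le> W (const (b - c))"
  then have "Fin \<gamma> \<le> min (V (a - b)) (V (b - c))" using b const[of "b - c"] by simp
  also have "\<dots> \<le> V (a - c)" using V.add_ge[of "a - b" "b - c"] by simp
  finally show "simple_degree Kh b \<le> simple_degree Kh c" by (rule min)
qed

end

section \<open>Comparison of the slopes and centres of the two extensions\<close>

context dense_ext2
begin

text \<open>\<open>\<gamma>\<close> is the value of \<open>X - a\<close>, where \<open>a\<close> is
  a root of a polynomial over \<open>K\<close>; by \<open>max_slope\<close> it is at most some
  \<open>W1 (X - d)\<close>, and these never exceed \<open>\<gamma>1\<close>. Agreement is used on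
  polynomials over \<open>K\<close> only, which is why \<open>a\<close> is taken algebraic over
  \<open>K\<close>.\<close>

lemma slope_le:
  assumes m: "is_monomial_valuation UNIV V a \<gamma> W" "is_monomial_valuation UNIV V a1 \<gamma>1 W1"
    and a: "a \<in> alg_cl K"
  shows "\<gamma> \<le> \<gamma>1"
proof -
  obtain p where p: "p \<in> polys_over K" "p \<noteq> 0" "poly p a = 0"
    using a unfolding alg_cl_iff[OF K] by blast
  obtain d where "W (indet - const a) \<le> W1 (indet - const d)"
    using max_slope[OF W.valued_axioms W1.W.valued_axioms K eq_K p] by blast
  then show ?thesis
    unfolding monomial_indet_const[OF m(1)] W1.monomial_indet_const[OF m(2)] by (simp add: V.zero)
qed

text \<open>Lying in the ball about \<open>a\<close> means that \<open>X - c\<close> has the maximal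
  value \<open>\<gamma>\<close>. Applied to the minimal polynomial of \<open>c\<close>,
  \<open>max_slope\<close> yields a conjugate with this property for \<open>W1\<close>; no
  automorphism has to be produced.\<close>

lemma conjugate_in_ball:
  assumes m: "is_monomial_valuation UNIV V a \<gamma> W" "is_monomial_valuation UNIV V a1 \<gamma> W1"
    and eq: "\<And>p. p \<in> polys_over Kh \<Longrightarrow> W (to_fract p) = W1 (to_fract p)"
    and c: "Fin \<gamma> \<le> V (a - c)"
  shows "\<exists>d. conjugate_over Kh c d \<and> Fin \<gamma> \<le> V (a1 - d)"
proof -
  have "c \<in> alg_cl Kh" using closure by simp
  then obtain p where p: "p \<in> polys_over Kh" "p \<noteq> 0" "poly p c = 0"
    "\<And>d. poly p d = 0 \<Longrightarrow> conjugate_over Kh c d"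
    using poly_with_conjugate_roots[OF Kh] by metis
  obtain d where d: "poly p d = 0" "W (indet - const c) \<le> W1 (indet - const d)"
    using max_slope[OF W.valued_axioms W1.W.valued_axioms Kh eq p(1-3)] by blast
  have "Fin \<gamma> \<le> V (a1 - d)"
    using d(2) c unfolding monomial_indet_const[OF m(1)] W1.monomial_indet_const[OF m(2)]
    by (simp add: min.absorb2)
  with p(4)[OF d(1)] show ?thesis by blast
qed

end

context dense_ext2
begin

interpretation S: dense_ext2 V K Kh W1 W by (rule swap)

text \<open>Every element of either ball has a conjugate, of the same degree, in the other. Hence
  the least degrees in the two balls coincide, and a conjugate in the second ball of a minimiser in
  the first is a minimiser again.\<close>

lemma conjugate_minimal_pairs:
  assumes m: "is_monomial_valuation UNIV V a \<gamma> W" "is_monomial_valuation UNIV V a1 \<gamma> W1"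
    and eq: "\<And>p. p \<in> polys_over Kh \<Longrightarrow> W (to_fract p) = W1 (to_fract p)"
  shows "\<exists>b b1. minimal_pair_of_definition Kh W b \<gamma> \<and> minimal_pair_of_definition Kh W1 b1 \<gamma> \<and>
    conjugate_over Kh b b1"
proof -
  have "Fin \<gamma> \<le> V (a - a)" by (simp add: V.zero)
  then obtain b where b: "Fin \<gamma> \<le> V (a - b)"
    "\<And>c. Fin \<gamma> \<le> V (a - c) \<Longrightarrow> simple_degree Kh b \<le> simple_degree Kh c"
    using ex_has_least_nat[of "\<lambda>c. Fin \<gamma> \<le> V (a - c)" a "simple_degree Kh"] by metis
  obtain b1 where b1: "conjugate_over Kh b b1" "Fin \<gamma> \<le> V (a1 - b1)"
    using conjugate_in_ball[OF m eq b(1)] by blast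
  have "simple_degree Kh b1 \<le> simple_degree Kh c1" if c1: "Fin \<gamma> \<le> V (a1 - c1)" for c1
  proof -
    obtain c where c: "conjugate_over Kh c1 c" "Fin \<gamma> \<le> V (a - c)"
      using S.conjugate_in_ball[OF m(2,1) eq[symmetric] c1] by blast
    then show ?thesis
      using b(2)[OF c(2)] simple_degree_conjugate[OF Kh c(1)] simple_degree_conjugate[OF Kh b1(1)]
      by simp
  qed
  then show ?thesis
    using minimal_pair_of_definition_Kh[OF m(1) b] W1.minimal_pair_of_definition_Kh[OF m(2) b1(2)] b1(1)
    by blast
qed

end


subsection \<open>Extensions by limits of pseudo-Cauchy sequences\<close>

context dense_ext
begin

text \<open>Equivalently, \<open>u\<close> is a nonzero constant times an element congruent to 1
  modulo the valuation ideal. In this form closure under products and inverses is natural, and both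
  value and residue of \<open>u\<close> can be taken from a constant.\<close>

definition approximable :: "'a poly fract \<Rightarrow> bool" where
  "approximable u \<longleftrightarrow> u \<noteq> 0 \<and> (\<exists>d. W u < W (u - const d))"

lemma approximableE:
  assumes "approximable u"
  obtains d \<alpha> where "d \<noteq> 0" "V d = Fin \<alpha>" "W u = Fin \<alpha>" "Fin \<alpha> < W (u - const d)"
proof -
  obtain d where d: "W u < W (u - const d)" and u: "u \<noteq> 0" using assms by (auto simp: approximable_def)
  obtain \<alpha> where \<alpha>: "W u = Fin \<alpha>" by (rule W.Fin[OF UNIV_I u])
  have "W (const d) = W u" by (rule W.eq_of_diff[OF _ _ d]) simp_all
  then have "V d = Fin \<alpha>" by (simp add: const \<alpha>)
  moreover from this have "d \<noteq> 0" by (auto simp: V.zero)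
  ultimately show ?thesis using that \<alpha> d by simp
qed

lemma approximable_const: "c \<noteq> 0 \<Longrightarrow> approximable (const c)"
  unfolding approximable_def using W.zero W.less_Pinf_iff[of "const c"] by (auto intro!: exI[of _ c])

text \<open>The error splits as \<open>(u - d) * u' + d * (u' - d')\<close>, and both summands have
  value larger than \<open>u * u'\<close>.\<close>

lemma approximable_mult:
  assumes "approximable u" "approximable u'" shows "approximable (u * u')"
proof -
  obtain d \<alpha> where d: "V d = Fin \<alpha>" "W u = Fin \<alpha>" "Fin \<alpha> < W (u - const d)"
    by (rule approximableE[OF assms(1)])
  obtain d' \<beta> where d': "W u' = Fin \<beta>" "Fin \<beta> < W (u' - const d')"
    by (rule approximableE[OF assms(2)])
  have "Fin \<alpha> + Fin \<beta> < W ((u - const d) * u')"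
    using d(3) by (simp only: W.mult[OF UNIV_I UNIV_I] d'(1) extended_add_less_cancel)
  moreover have "Fin \<alpha> + Fin \<beta> < W (const d * (u' - const d'))"
    using d'(2) by (simp only: W.mult[OF UNIV_I UNIV_I] const d(1) extended_add_less_cancel)
  ultimately have "W (u * u') < min (W ((u - const d) * u')) (W (const d * (u' - const d')))"
    by (simp add: W.mult d d')
  also have "\<dots> \<le> W ((u - const d) * u' + const d * (u' - const d'))" by (rule W.add_ge) simp_all
  also have "(u - const d) * u' + const d * (u' - const d') = u * u' - const (d * d')"
    by (simp add: algebra_simps)
  finally have "W (u * u') < W (u * u' - const (d * d'))" .
  moreover have "u * u' \<noteq> 0" using assms by (simp add: approximable_def)
  ultimately show ?thesis unfolding approximable_def by blast
qed

lemma approximable_inverse: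
  assumes "approximable u" shows "approximable (inverse u)"
proof -
  obtain d \<alpha> where d: "d \<noteq> 0" "V d = Fin \<alpha>" "W u = Fin \<alpha>" "Fin \<alpha> < W (u - const d)"
    by (rule approximableE[OF assms])
  have u: "u \<noteq> 0" using assms by (simp add: approximable_def)
  have iu: "W (inverse u) = Fin (- \<alpha>)" by (rule W.inverse[OF UNIV_I d(3)])
  have "W (inverse (const d)) = Fin (- \<alpha>)" by (rule W.inverse) (simp_all add: const d)
  then have "W (inverse u * inverse (const d)) = Fin (- \<alpha> - \<alpha>)" by (simp add: W.mult iu)
  moreover have "inverse u - const (inverse d) = (const d - u) * (inverse u * inverse (const d))"
    unfolding const_inverse using u d(1) by (simp add: field_simps)
  ultimately have "W (inverse u - const (inverse d)) = W (u - const d) + Fin (- \<alpha> - \<alpha>)"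
    by (simp add: W.mult W.minus_commute[of "const d" u])
  moreover have "Fin \<alpha> + Fin (- \<alpha> - \<alpha>) < W (u - const d) + Fin (- \<alpha> - \<alpha>)"
    using d(4) by (simp only: extended_add_less_cancel)
  ultimately have "W (inverse u) < W (inverse u - const (inverse d))" using iu by simp
  moreover have "inverse u \<noteq> 0" using u by simp
  ultimately show ?thesis unfolding approximable_def by blast
qed

context
  assumes immediate: "\<And>c. \<exists>z. W (indet - const c) < W (indet - const z)"
begin

text \<open>If \<open>z\<close> approximates \<open>X\<close> better than \<open>c\<close> does,
  then \<open>z - c\<close> approximates \<open>X - c\<close> with error
  \<open>X - z\<close>.\<close>

lemma approximable_linear: "approximable (indet - const c)"
proof -
  obtain z where "W (indet - const c) < W (indet - const z)" using immediate by blast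
  moreover have "indet - const c - const (z - c) = indet - const z" by simp
  ultimately show ?thesis using indet_neq_const[of c] unfolding approximable_def by (metis eq_iff_diff_eq_0)
qed

lemma approximable_to_fract:
  assumes "p \<noteq> 0" shows "approximable (to_fract p)"
proof -
  obtain A where A: "p = smult (Polynomial.lead_coeff p) (\<Prod>x\<in>#A. [:- x, 1:])"
    using polynomial_splits[OF assms] by blast
  have "approximable (to_fract (\<Prod>x\<in>#A. [:- x, 1:]))"
  proof (induction A)
    case empty
    then show ?case using approximable_const[of 1] by simp
  next
    case (add x A)
    then show ?case
      using approximable_mult[OF approximable_linear[of x] add]
      by (simp add: to_fract_linear del: mult_pCons_left)
  qed
  then have "approximable (const (Polynomial.lead_coeff p) * to_fract (\<Prod>x\<in>#A. [:- x, 1:]))"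
    using assms by (intro approximable_mult approximable_const) simp_all
  then show ?thesis using A by (metis to_fract_smult)
qed

lemma approximable_all:
  assumes "u \<noteq> 0" shows "approximable u"
proof -
  obtain p q where u: "u = to_fract p / to_fract q" and q: "q \<noteq> 0" by (rule fract_cases)
  then have "p \<noteq> 0" using assms by auto
  then show ?thesis
    unfolding u divide_inverse
    using q by (intro approximable_mult approximable_inverse approximable_to_fract)
qed

text \<open>Every value is that of an approximating constant, and constants are algebraic over
  \<open>Kh\<close>; so every value has a positive multiple among the values of \<open>Kh\<close>,
  and none is rationally independent of them.\<close>

lemma not_value_transcendental: "\<not> value_transcendental Kh W"
proof
  assume "value_transcendental Kh W"
  then obtain s where s: "s \<in> value_group W (ratfuns Kh)"
    and ind: "\<And>k. int_mult (k s) s \<in> value_group W (const ` Kh) \<Longrightarrow> k s = 0"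
    unfolding value_transcendental_def has_rational_rank_def by (auto simp: card_1_singleton_iff)
  obtain u where u: "W u = Fin s" using s by (auto simp: value_group_def)
  then have "u \<noteq> 0" by (auto simp: W.zero)
  then obtain d where "V d = Fin s" using approximableE[OF approximable_all] u
    by (metis extended.inject)
  then obtain m where m: "m > 0" "nat_mult m s \<in> value_group V Kh"
    using torsion value_group_eq by blast
  then have "int_mult (int m) s \<in> value_group W (const ` Kh)"
    by (auto simp: value_group_def const)
  then show False using ind[of "\<lambda>_. int m"] m by simp
qed

end

end


subsection \<open>Residue fields\<close>

context valued
begin

lemma valuation_ring_ring: "ring (valuation_ring v F)"
proof -
  have "0 \<le> v (x + y)" if "x \<in> F" "y \<in> F" "0 \<le> v x" "0 \<le> v y" for x y
    using add_ge[OF that(1,2)] that(3,4) by (meson min.boundedI order_trans)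
  moreover have "0 \<le> v (x * y)" if "x \<in> F" "y \<in> F" "0 \<le> v x" "0 \<le> v y" for x y
    using add_mono[OF that(3,4)] mult[OF that(1,2)] by simp
  ultimately have "subring {x \<in> F. 0 \<le> v x} ambient"
    by (intro ambient.subringI) (simp_all add: one uminus)
  then show ?thesis unfolding valuation_ring_def by (rule ambient.subring_is_ring)
qed

lemma valuation_ring_simps [simp]:
  "carrier (valuation_ring v F) = {x \<in> F. 0 \<le> v x}"
  "x \<otimes>\<^bsub>valuation_ring v F\<^esub> y = x * y" "\<one>\<^bsub>valuation_ring v F\<^esub> = 1"
  "x \<oplus>\<^bsub>valuation_ring v F\<^esub> y = x + y" "\<zero>\<^bsub>valuation_ring v F\<^esub> = 0"
  by (simp_all add: valuation_ring_def)

lemma valuation_ring_a_inv: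
  assumes "x \<in> F" "0 \<le> v x" shows "\<ominus>\<^bsub>valuation_ring v F\<^esub> x = - x"
proof -
  interpret R: ring "valuation_ring v F" by (rule valuation_ring_ring)
  show ?thesis using assms by (intro R.minus_equality) (simp_all add: uminus)
qed

lemma valuation_ideal_ideal: "ideal (valuation_ideal v F) (valuation_ring v F)"
proof -
  interpret R: ring "valuation_ring v F" by (rule valuation_ring_ring)
  have add: "0 < v (x + y)" if "x \<in> F" "y \<in> F" "0 < v x" "0 < v y" for x y
    using add_ge[OF that(1,2)] that(3,4) by (meson min_less_iff_conj order.strict_trans2)
  have mul: "0 < v (x * y)" if "x \<in> F" "y \<in> F" "0 < v x" "0 \<le> v y" for x y
    using extended_add_less_le[of 0 "v x" 0 "v y"] that mult[OF that(1,2)] by (simp flip: zero_extended_def)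
  show ?thesis
  proof (rule idealI)
    show "ring (valuation_ring v F)" by (rule valuation_ring_ring)
    show "subgroup (valuation_ideal v F) (add_monoid (valuation_ring v F))"
    proof (rule R.add.subgroupI)
      show "valuation_ideal v F \<subseteq> carrier (valuation_ring v F)"
        by (auto simp: valuation_ideal_def)
      show "valuation_ideal v F \<noteq> {}" using zero closed(2) by (auto simp: valuation_ideal_def intro!: exI[of _ 0])
    qed (auto simp: valuation_ideal_def valuation_ring_a_inv uminus add)
  qed (auto simp: valuation_ideal_def mul, metis mul mult.commute)
qed

lemma residue_hom:
  "ring_hom_ring (valuation_ring v F) (residue_field v F) (\<lambda>x. valuation_ideal v F +>\<^bsub>valuation_ring v F\<^esub> x)"
  unfolding residue_field_def using ideal.rcos_ring_hom_ring[OF valuation_ideal_ideal] .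

lemma residue_eq_zero_iff:
  assumes "x \<in> F" "0 \<le> v x"
  shows "valuation_ideal v F +>\<^bsub>valuation_ring v F\<^esub> x = \<zero>\<^bsub>residue_field v F\<^esub> \<longleftrightarrow> 0 < v x"
proof -
  interpret I: ideal "valuation_ideal v F" "valuation_ring v F" by (rule valuation_ideal_ideal)
  have "\<zero>\<^bsub>residue_field v F\<^esub> = valuation_ideal v F"
    by (simp add: residue_field_def FactRing_def)
  moreover have "x \<in> valuation_ideal v F \<Longrightarrow> valuation_ideal v F +>\<^bsub>valuation_ring v F\<^esub> x = valuation_ideal v F"
    by (rule I.a_rcos_const)
  moreover have "x \<in> valuation_ideal v F +>\<^bsub>valuation_ring v F\<^esub> x"
    using assms by (intro I.a_rcos_self) simp
  ultimately show ?thesis using assms by (auto simp: valuation_ideal_def)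
qed

text \<open>Reducing the coefficients of \<open>p\<close> gives a polynomial that annihilates the
  residue of \<open>u\<close>, as \<open>p(u)\<close> has positive value, and that is nonzero
  because of the unit coefficient.\<close>

lemma residue_algebraic:
  assumes u: "u \<in> F" "0 \<le> v u" and L: "L \<subseteq> F" and p: "p \<in> polys_over L"
    and nonneg: "\<And>i. 0 \<le> v (poly.coeff p i)" and unit: "v (poly.coeff p j) = 0"
    and small: "0 < v (poly p u)" and k: "residue_subfield v F L \<subseteq> k"
  shows "ring.algebraic (residue_field v F) k (valuation_ideal v F +>\<^bsub>valuation_ring v F\<^esub> u)"
proof -
  define h where "h x = valuation_ideal v F +>\<^bsub>valuation_ring v F\<^esub> x" for x
  interpret H: ring_hom_ring "valuation_ring v F" "residue_field v F" h
    using residue_hom unfolding h_def .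
  define l where "l = rev (coeffs p)"
  have cl: "x \<in> L \<and> 0 \<le> v x" if "x \<in> set l" for x
  proof -
    have "x \<in> range (poly.coeff p)" using that by (simp add: range_coeff l_def)
    then show ?thesis using nonneg coeff_polys_over[OF p] by auto
  qed
  then have lR: "set l \<subseteq> carrier (valuation_ring v F)" using L by auto
  have uR: "u \<in> carrier (valuation_ring v F)" using u by simp
  have "subring {x \<in> F. 0 \<le> v x} ambient"
    using valuation_ring_ring unfolding valuation_ring_def by (intro ambient.ring_incl_imp_subring) simp_all
  then have "ring.eval (valuation_ring v F) l u = ambient.eval l u"
    unfolding valuation_ring_def by (simp add: ambient.eval_consistent)
  also have "\<dots> = poly p u" by (simp add: eval_eq_poly l_def)
  finally have ev: "H.R.eval l u = poly p u" .
  have mem: "poly p u \<in> F"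
    using H.R.eval_in_carrier[OF lR uR] unfolding ev by simp
  have "H.S.eval (map h l) (h u) = h (H.R.eval l u)" using H.eval_hom'[OF uR lR] by simp
  also have "\<dots> = \<zero>\<^bsub>residue_field v F\<^esub>"
    unfolding ev h_def using residue_eq_zero_iff[OF mem] small by simp
  finally have ev0: "H.S.eval (map h l) (h u) = \<zero>\<^bsub>residue_field v F\<^esub>" .
  have hk: "set (map h l) \<subseteq> k"
  proof
    fix y assume "y \<in> set (map h l)"
    then obtain x where "x \<in> set l" "y = h x" by auto
    then have "y \<in> residue_subfield v F L"
      using cl unfolding residue_subfield_def h_def by (auto simp: valuation_ring_def)
    then show "y \<in> k" using k by auto
  qed
  have hE: "set (map h l) \<subseteq> carrier (residue_field v F)" using lR H.hom_closed by auto
  \<comment> \<open>Leading coefficients may reduce to zero, whereas members of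
    \<open>univ_poly\<close> must start with a nonzero entry.\<close>
  define q where "q = H.S.normalize (map h l)"
  have "q \<noteq> []"
  proof
    assume "q = []"
    then have rep: "map h l = replicate (length (map h l)) \<zero>\<^bsub>residue_field v F\<^esub>"
      using H.S.normalize_trick[of "map h l"] by (simp add: q_def)
    have "poly.coeff p j \<noteq> 0" using unit zero by auto
    then have "poly.coeff p j \<in> set l" unfolding l_def set_rev
      using range_coeff by blast
    then have "h (poly.coeff p j) \<in> set (map h l)" by simp
    then have "h (poly.coeff p j) = \<zero>\<^bsub>residue_field v F\<^esub>"
      using rep by (metis in_set_replicate)
    moreover have "poly.coeff p j \<in> F" using coeff_polys_over[OF p] L by auto
    ultimately show False
      using residue_eq_zero_iff[of "poly.coeff p j"] unit by (simp add: h_def)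
  qed
  moreover have "q \<in> carrier (univ_poly (residue_field v F) k)"
    using H.S.normalize_gives_polynomial[OF hk] by (simp add: q_def univ_poly_def)
  moreover have "H.S.eval q (h u) = \<zero>\<^bsub>residue_field v F\<^esub>"
    using H.S.eval_normalize[OF hE, of "h u"] H.hom_closed[OF uR] ev0 by (simp add: q_def)
  ultimately show ?thesis
    using H.S.algebraicI[of q k "h u"] by (simp add: over_def h_def)
qed

end

section \<open>Residues of elements approximated by constants\<close>

context dense_ext
begin

text \<open>Polynomials with integral coefficients respect congruence modulo the valuation ideal.
  With \<open>P(u)\<close> the value of \<open>p\<close> at \<open>u\<close>, the Horner step leaves
  the error \<open>u * (P(u) - p(d)) + (u - d) * p(d)\<close>.\<close>

lemma poly_residue:
  assumes nonneg: "\<And>i. 0 \<le> V (poly.coeff p i)" and u: "0 \<le> W u" and d: "0 < W (u - const d)"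
  shows "0 \<le> V (poly p d) \<and> 0 < W (poly (map_poly const p) u - const (poly p d))"
  using nonneg
proof (induction p)
  case 0
  then show ?case by (simp add: V.zero W.zero)
next
  case (pCons c p)
  have c: "0 \<le> V c" using pCons.prems[of 0] by simp
  have IH: "0 \<le> V (poly p d)" "0 < W (poly (map_poly const p) u - const (poly p d))"
    using pCons.IH pCons.prems[of "Suc i" for i] by simp_all
  have "0 \<le> min (W u) (W (u - const d))" using u d by simp
  also have "\<dots> \<le> W (const d)" using W.diff_ge[of u "u - const d"] by simp
  finally have Vd: "0 \<le> V d" by (simp add: const)
  have "0 \<le> V (d * poly p d)" using add_mono[OF Vd IH(1)] by (simp add: V.mult)
  then have 1: "0 \<le> V (poly (pCons c p) d)" using c V.add_ge[of c "d * poly p d"]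
    by simp (meson min.boundedI order_trans)
  have "0 < W (u * (poly (map_poly const p) u - const (poly p d)))"
    using extended_add_less_le[of 0 _ 0 "W u", OF IH(2)] u
    by (simp add: W.mult add.commute flip: zero_extended_def)
  moreover have "0 < W ((u - const d) * const (poly p d))"
    using extended_add_less_le[of 0 _ 0 "V (poly p d)", OF d] IH(1)
    by (simp add: W.mult const flip: zero_extended_def)
  ultimately have "0 < min (W (u * (poly (map_poly const p) u - const (poly p d)))) (W ((u - const d) * const (poly p d)))"
    by simp
  also have "\<dots> \<le> W (u * (poly (map_poly const p) u - const (poly p d)) + (u - const d) * const (poly p d))"
    by (rule W.add_ge) simp_all
  also have "u * (poly (map_poly const p) u - const (poly p d)) + (u - const d) * const (poly p d) =
      poly (map_poly const (pCons c p)) u - const (poly (pCons c p) d)"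
    by (simp add: map_poly_pCons algebra_simps)
  finally show ?case using 1 by blast
qed

text \<open>Divide an algebraic equation of \<open>d\<close> over \<open>Kh\<close> by a coefficient
  of least value.\<close>

lemma primitive_polynomial:
  "\<exists>p j. p \<in> polys_over Kh \<and> poly p d = 0 \<and> (\<forall>i. 0 \<le> V (poly.coeff p i)) \<and> V (poly.coeff p j) = 0"
proof -
  have "d \<in> alg_cl Kh" using closure by simp
  then obtain q where q: "q \<in> polys_over Kh" "q \<noteq> 0" "poly q d = 0"
    unfolding alg_cl_iff[OF Kh] by blast
  let ?I = "{..Polynomial.degree q}" and ?f = "\<lambda>i. V (poly.coeff q i)"
  have fin: "finite ?I" "?I \<noteq> {}" by auto
  define j where "j = arg_min_on ?f ?I"
  have j: "?f j \<le> ?f i" for i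
  proof (cases "i \<in> ?I")
    case True
    then show ?thesis unfolding j_def by (rule arg_min_least[OF fin])
  next
    case False
    then show ?thesis by (simp add: coeff_eq_0 V.zero)
  qed
  have "?f (Polynomial.degree q) \<noteq> Pinf" using q(2) V.Pinf_iff by simp
  then have "?f j \<noteq> Pinf" using j[of "Polynomial.degree q"] by auto
  then obtain \<alpha> where \<alpha>: "?f j = Fin \<alpha>" using V.not_Minf[of "poly.coeff q j"] by (cases "?f j") auto
  let ?p = "smult (inverse (poly.coeff q j)) q"
  have inv: "V (inverse (poly.coeff q j)) = Fin (- \<alpha>)" by (rule V.inverse[OF UNIV_I \<alpha>])
  have *: "V (poly.coeff ?p i) = Fin (- \<alpha>) + ?f i" for i by (simp add: V.mult inv)
  show ?thesis
  proof (intro exI[of _ ?p] exI[of _ j] conjI allI)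
    show "?p \<in> polys_over Kh"
      using coeff_polys_over[OF q(1)] by (auto simp: polys_over_def)
    show "poly ?p d = 0" using q by simp
    show "V (poly.coeff ?p j) = 0" unfolding * \<alpha> by simp
    show "0 \<le> V (poly.coeff ?p i)" for i
      unfolding * using j[of i] \<alpha> by (cases "?f i") auto
  qed
qed

text \<open>Every residue is the residue of a constant \<open>d\<close>, and is therefore a root of
  the reduction of a primitive equation of \<open>d\<close> over \<open>Kh\<close>.\<close>

lemma not_residue_transcendental:
  assumes immediate: "\<And>c. \<exists>z. W (indet - const c) < W (indet - const z)"
  shows "\<not> residue_transcendental Kh W"
proof
  interpret L: valued "ratfuns Kh" W
    using W.valuation by (intro valued.intro subfield_ratfuns) (simp add: valuation_on_def)
  let ?E = "residue_field W (ratfuns Kh)" and ?k = "residue_subfield W (ratfuns Kh) (const ` Kh)"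
  assume "residue_transcendental Kh W"
  then obtain s where s: "s \<in> carrier ?E" and tr: "ring.transcendental ?E (generate_field ?E ?k) s"
    unfolding residue_transcendental_def has_trdeg_def by (auto simp: card_1_singleton_iff)
  obtain u where u: "u \<in> ratfuns Kh" "0 \<le> W u"
    "s = valuation_ideal W (ratfuns Kh) +>\<^bsub>valuation_ring W (ratfuns Kh)\<^esub> u"
    using s by (auto simp: residue_field_def FactRing_def A_RCOSETS_def')
  have "\<exists>d. 0 < W (u - const d)"
  proof (cases "0 < W u")
    case True
    then show ?thesis by (intro exI[of _ 0]) simp
  next
    case False
    then have "u \<noteq> 0" by (auto simp: W.zero)
    then show ?thesis
      using approximable_all[OF immediate, of u] u(2) unfolding approximable_def
      by (meson order.strict_trans1)
  qed
  then obtain d where d: "0 < W (u - const d)" by blast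
  obtain p j where p: "p \<in> polys_over Kh" "poly p d = 0" "\<And>i. 0 \<le> V (poly.coeff p i)" "V (poly.coeff p j) = 0"
    using primitive_polynomial[of d] by blast
  have "0 < W (poly (map_poly const p) u)" using poly_residue[OF p(3) u(2) d] p(2) by simp
  moreover have "map_poly const p \<in> polys_over (const ` Kh)"
    using p(1) by (simp add: polys_over_def)
  moreover have "const ` Kh \<subseteq> ratfuns Kh" by (auto intro: const_ratfuns)
  moreover have "?k \<subseteq> generate_field ?E ?k" by (auto intro: generate_field.incl)
  ultimately have "ring.algebraic ?E (generate_field ?E ?k) s"
    unfolding u(3) using p(3,4) u(1,2) by (intro L.residue_algebraic[where p = "map_poly const p" and j = j]) (auto simp: const)
  with tr show False by simp
qed

end

context dense_ext2
begin

text \<open>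
  If \<open>\<gamma>\<close> exceeds all values, then \<open>W\<close> is large on every polynomial over \<open>K\<close> that is close to one
  vanishing at \<open>a\<close>, whereas an immediate \<open>W1\<close> is bounded there.
\<close>

lemma infinite_slope_not_immediate:
  assumes m: "is_monomial_valuation UNIV V a \<gamma> W" and \<gamma>: "\<And>\<beta>. \<beta> \<in> \<Gamma> \<Longrightarrow> \<beta> < \<gamma>"
    and immediate: "\<And>c. \<exists>z. W1 (indet - const c) < W1 (indet - const z)"
  shows False
proof -
  have "a \<in> alg_cl Kh" using closure by simp
  then obtain f where f: "f \<in> polys_over Kh" "f \<noteq> 0" "poly f a = 0"
    unfolding alg_cl_iff[OF Kh] by blast
  obtain d \<theta> where d: "d \<noteq> 0" "V d = Fin \<theta>" "W1 (to_fract f) = Fin \<theta>"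
    using W1.approximableE[OF W1.approximable_to_fract[OF immediate f(2)]] by metis
  \<comment> \<open>\<open>W1 f\<close> is the value of a constant, hence bounded in
    \<open>\<Gamma>\<close>. A sufficiently close approximation \<open>g\<close> of \<open>f\<close>
    over \<open>K\<close> keeps this value under \<open>W1\<close>, but has value above
    \<open>\<delta>\<close> under \<open>W\<close>.\<close>
  obtain \<delta> where \<delta>: "\<delta> \<in> \<Gamma>" "V d \<le> Fin \<delta>" by (rule value_le[OF d(1)])
  obtain \<alpha> where \<alpha>: "\<alpha> \<in> \<Gamma>" "Fin \<alpha> \<le> V a" by (rule value_ge)
  \<comment> \<open>A common lower bound for \<open>V a\<close> and for the value of
    \<open>indet\<close>, which is the same under \<open>W\<close> and \<open>W1\<close>; one choice
    of error bounds thus controls \<open>f - g\<close> both at \<open>a\<close> and under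
    \<open>W1\<close>.\<close>
  define \<xi> where "\<xi> = min 0 \<alpha>"
  have \<xi>: "\<xi> \<in> \<Gamma>" unfolding \<xi>_def by (rule \<Gamma>_min[OF K.value_group_zero \<alpha>(1)])
  have \<xi>a: "Fin \<xi> \<le> V a" using \<alpha>(2) by (cases "V a") (auto simp: \<xi>_def min_le_iff_disj)
  have "Fin \<xi> \<le> Fin \<gamma>" using \<gamma>[OF \<xi>] by simp
  then have "Fin \<xi> \<le> W indet" using \<xi>a unfolding monomial_indet[OF m] by simp
  then have \<xi>X: "Fin \<xi> \<le> W1 indet" by (simp add: eq_indet)
  have "\<delta> - nat_mult i \<xi> \<in> \<Gamma>" for i by (intro K.value_group_diff K.value_group_nat_mult \<delta> \<xi>)
  then obtain g where g: "g \<in> polys_over K" "\<And>i. Fin (\<delta> - nat_mult i \<xi>) < V (poly.coeff (f - g) i)"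
    using approx[OF f(1), of "\<lambda>i. \<delta> - nat_mult i \<xi>"] by metis
  have g': "Fin \<delta> < V (poly.coeff (f - g) i) + Fin (nat_mult i \<xi>)" for i
    unfolding Fin_less_add_iff by (rule g(2))
  have "Fin \<delta> < W1 (to_fract (f - g))" by (rule W1.to_fract_gt[OF g' \<xi>X])
  then have "W1 (to_fract f) < W1 (to_fract f - to_fract g)" 
    using order.strict_trans1[OF \<delta>(2)] by (simp add: d)
  then have 1: "W1 (to_fract g) = W1 (to_fract f)" by (intro W1.W.eq_of_diff) simp_all
  have "Fin \<delta> < V (poly (f - g) a)" by (rule V.poly_gt[OF refl g' \<xi>a])
  then have "Fin \<delta> < W (const (poly g a))" using f(3) V.uminus[of "poly g a"] by (simp add: const)
  moreover have "Fin \<delta> < W (to_fract g - const (poly g a))" by (rule infinite_slope[OF m \<gamma> \<delta>(1)])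
  ultimately have "Fin \<delta> < min (W (to_fract g - const (poly g a))) (W (const (poly g a)))" by simp
  also have "\<dots> \<le> W (to_fract g - const (poly g a) + const (poly g a))" by (rule W.add_ge) simp_all
  finally have "Fin \<delta> < W (to_fract g)" by simp
  then show False using eq_K[OF g(1)] 1 d \<delta>(2) by simp
qed

end

text \<open>Used at two levels: \<open>wb\<close> and \<open>wb1\<close> agree on
  \<open>K(X)\<close> and so fall under the same case of the construction, and \<open>W\<close> and
  \<open>W1\<close> have the same type once they agree on \<open>Kh(X)\<close>.\<close>

lemma valuation_transcendental_cong:
  assumes eq: "\<And>x. x \<in> ratfuns F \<Longrightarrow> w x = w' x"
  shows "valuation_transcendental F w \<longleftrightarrow> valuation_transcendental F w'"
proof -
  have c: "const ` F \<subseteq> ratfuns F" by (auto intro: const_ratfuns)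
  have g: "value_group w S = value_group w' S" if "S \<subseteq> ratfuns F" for S
    using eq that unfolding value_group_def by (metis (no_types, lifting) subsetD)
  have r: "valuation_ring w S = valuation_ring w' S" if "S \<subseteq> ratfuns F" for S
  proof -
    have "{x \<in> S. 0 \<le> w x} = {x \<in> S. 0 \<le> w' x}" using eq that by auto
    then show ?thesis by (simp add: valuation_ring_def)
  qed
  have i: "valuation_ideal w (ratfuns F) = valuation_ideal w' (ratfuns F)"
    using eq by (auto simp: valuation_ideal_def)
  show ?thesis
    unfolding valuation_transcendental_def value_transcendental_def residue_transcendental_def
      residue_field_def residue_subfield_def g[OF c] g[OF order_refl] r[OF c] r[OF order_refl] i ..
qed


subsection \<open>The induced extension\<close>

lemma monomial_const:
  assumes "is_monomial_valuation UNIV v a \<gamma> w" shows "w (const c) = v c"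
proof -
  have "w (to_fract [:c:]) = Min ((\<lambda>i. v (poly.coeff (pcompose [:c:] [:a, 1:]) i) + Fin (nat_mult i \<gamma>)) `
      {..Polynomial.degree [:c:]})"
    using assms by (simp add: is_monomial_valuation_def)
  then show ?thesis by (simp add: const_def flip: zero_extended_def)
qed

lemma limit_order_suc:
  assumes "limit_order r" "\<nu> \<in> Field r"
  shows "wo_rel.suc r {\<nu>} \<in> Field r" "(\<nu>, wo_rel.suc r {\<nu>}) \<in> r" "wo_rel.suc r {\<nu>} \<noteq> \<nu>"
proof -
  interpret wo_rel r using assms(1) by (simp add: wo_rel_def limit_order_def)
  obtain \<mu> where "(\<nu>, \<mu>) \<in> r" "\<mu> \<noteq> \<nu>" using assms unfolding limit_order_def by blast
  then have "\<mu> \<in> AboveS {\<nu>}" by (auto simp: AboveS_def Field_def)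
  then have ne: "AboveS {\<nu>} \<noteq> {}" by blast
  show "suc {\<nu>} \<in> Field r" using assms(2) ne by (intro suc_inField) auto
  show "(\<nu>, suc {\<nu>}) \<in> r" "suc {\<nu>} \<noteq> \<nu>" using suc_greater[of "{\<nu>}" \<nu>] assms(2) ne by auto
qed

section \<open>Cofinal sequences of approximations to \<open>X\<close>\<close>

locale cofinal_approximation =
  fixes E :: "'a::field set" and v :: "'a \<Rightarrow> 'g::linordered_ab_group_add extended"
    and wb :: "'a poly fract \<Rightarrow> 'g extended" and r :: "'i rel" and g z
  assumes E: "subfield E ambient" and v: "valuation_on UNIV v"
    and wb: "valuation_on (ratfuns E) wb" and wb_const: "\<And>c. c \<in> E \<Longrightarrow> wb (const c) = v c"
    and r: "limit_order r"
    and g: "strict_cofinal_seq r g {wb (indet - const c) | c. c \<in> E}"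
    and z: "\<And>\<nu>. \<nu> \<in> Field r \<Longrightarrow> z \<nu> \<in> E \<and> wb (indet - const (z \<nu>)) = g \<nu>"
begin

sublocale wb: valued "ratfuns E" wb
  using wb by (intro valued.intro subfield_ratfuns)

sublocale v: valued UNIV v
  using v by (rule valued_UNIV)

lemma linear_closed: "c \<in> E \<Longrightarrow> indet - const c \<in> ratfuns E"
  by (intro wb.closed indet_ratfuns const_ratfuns)

lemma step: "\<nu> \<in> Field r \<Longrightarrow> g \<nu> < g (wo_rel.suc r {\<nu>})"
  using g limit_order_suc[OF r] unfolding strict_cofinal_seq_def by metis

text \<open>Cofinality gives only a weak inequality; passing to the successor index, which exists in
  a limit order, makes it strict.\<close>

lemma exceed:
  assumes "c \<in> E" obtains \<nu> where "\<nu> \<in> Field r" "wb (indet - const c) < g \<nu>"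
proof -
  obtain \<nu> where \<nu>: "\<nu> \<in> Field r" "wb (indet - const c) \<le> g \<nu>"
    using g assms unfolding strict_cofinal_seq_def by blast
  then have "wb (indet - const c) < g (wo_rel.suc r {\<nu>})" using step by (metis order.strict_trans1)
  then show ?thesis using that limit_order_suc(1)[OF r \<nu>(1)] by blast
qed

text \<open>Expresses values of \<open>wb\<close> on linear factors through differences of
  constants, where every extension of \<open>v\<close> is prescribed.\<close>

lemma diff_value:
  assumes "c \<in> E" "d \<in> E" "wb (indet - const c) < wb (indet - const d)"
  shows "v (c - d) = wb (indet - const c)"
proof -
  have "wb ((indet - const c) - (indet - const d)) = wb (indet - const c)"
    using assms by (intro wb.diff_eq linear_closed)
  also have "(indet - const c) - (indet - const d) = const (d - c)" by simp
  finally show ?thesis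
    using wb_const[OF subfield_diff[OF E assms(2,1)]] v.minus_commute[of c d] by simp
qed

lemma diff_value_seq:
  assumes "\<nu> \<in> Field r" shows "v (z \<nu> - z (wo_rel.suc r {\<nu>})) = g \<nu>"
  using diff_value[of "z \<nu>" "z (wo_rel.suc r {\<nu>})"] step[OF assms] z[OF assms]
    z[OF limit_order_suc(1)[OF r assms]] by simp

text \<open>Here \<open>y\<close> is a limit in the ambient field, with \<open>e\<close> the identity, or \<open>X\<close>, with \<open>e\<close> the embedding of constants.\<close>

lemma limit_linear_value:
  assumes U: "valued UNIV U" and Ue: "\<And>c. U (e c) = lex_embed (v c)"
    and e: "\<And>c d. e (c - d) = e c - e d"
    and lim: "\<And>\<nu>. \<nu> \<in> Field r \<Longrightarrow> U (y - e (z \<nu>)) = lex_embed (g \<nu>)" and c: "c \<in> E"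
  shows "U (y - e c) = lex_embed (wb (indet - const c))"
proof -
  interpret U: valued UNIV U by fact
  obtain \<nu> where \<nu>: "\<nu> \<in> Field r" "wb (indet - const c) < g \<nu>" by (rule exceed[OF c])
  have "U (e (z \<nu> - c)) = lex_embed (wb (indet - const c))"
    using diff_value[of c "z \<nu>"] c z[OF \<nu>(1)] \<nu>(2) v.minus_commute[of c "z \<nu>"] by (simp add: Ue)
  then have "U (e (z \<nu> - c) + (y - e (z \<nu>))) = lex_embed (wb (indet - const c))"
    using lim[OF \<nu>(1)] \<nu>(2) U.add_eq[of "e (z \<nu> - c)" "y - e (z \<nu>)"] by simp
  then show ?thesis by (simp add: e)
qed

end

text \<open>All that is used about the construction, freed from the choices made in it. Without a
  limit, the sequence itself is forgotten and only the absence of a best constant approximation of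
  \<open>X\<close> is kept. Agreement with \<open>wb\<close> has to be checked on
  \<open>X - c\<close> for \<open>c\<close> in \<open>alg_cl K\<close> only, since polynomials over
  \<open>K\<close> split there.\<close>

lemma induced_extension_cases:
  fixes K :: "'a::alg_closed_field set" and vhb :: "'a \<Rightarrow> 'g::linordered_ab_group_add extended"
  assumes K: "subfield K ambient" and v: "valuation_on UNIV vhb"
    and wb: "valuation_on (ratfuns (alg_cl K)) wb" and wb_const: "\<And>c. c \<in> alg_cl K \<Longrightarrow> wb (const c) = vhb c"
    and W: "is_induced_extension K vhb wb W"
  defines "V \<equiv> \<lambda>c. lex_embed (vhb c)"
  shows "valuation_on UNIV W \<and> (\<forall>c. W (const c) = V c) \<and>
    (\<forall>p\<in>polys_over K. W (to_fract p) = lex_embed (wb (to_fract p))) \<and>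
    (if valuation_transcendental K wb
     then \<exists>a\<in>alg_cl K. \<exists>\<gamma>. is_monomial_valuation UNIV V a (0, \<gamma>) W
     else (\<exists>a. is_monomial_valuation UNIV V a (1, 0) W) \<or>
       (\<forall>c. \<exists>z. W (indet - const c) < W (indet - const z)))"
proof -
  have E: "subfield (alg_cl K) ambient" by (rule subfield_alg_cl[OF K])
  interpret v: valued UNIV vhb using v by (rule valued_UNIV)
  interpret V: valued UNIV V unfolding V_def by (rule valued_lex_embed[OF v.valued_axioms])
  interpret wb: valued "ratfuns (alg_cl K)" wb using wb by (intro valued.intro subfield_ratfuns)
  have reduce: "\<forall>p\<in>polys_over K. W (to_fract p) = lex_embed (wb (to_fract p))"
    if W: "valuation_on UNIV W" "\<And>c. W (const c) = V c"
      and lin: "\<And>c. c \<in> alg_cl K \<Longrightarrow> W (indet - const c) = lex_embed (wb (indet - const c))"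
  proof
    have "W (const c) = lex_embed (wb (const c))" if "c \<in> K" for c
      using that subset_alg_cl[OF K] W(2)[of c] wb_const[of c] by (auto simp: V_def)
    then show "W (to_fract p) = lex_embed (wb (to_fract p))" if "p \<in> polys_over K" for p
      using lex_embed_value_of_poly[OF valued_UNIV[OF W(1)] wb.valued_axioms K _ lin that] by blast
  qed
  show ?thesis
  proof (cases "valuation_transcendental K wb")
    case True
    then obtain a \<gamma> where pair: "pair_of_definition K wb a \<gamma>"
      and m: "is_monomial_valuation UNIV V a (0, \<gamma>) W"
      using W unfolding is_induced_extension_def V_def by auto
    have a: "a \<in> alg_cl K" and mb: "is_monomial_valuation (alg_cl K) (\<lambda>c. wb (const c)) a \<gamma> wb"
      using pair by (auto simp: pair_of_definition_def)
    have Wv: "valuation_on UNIV W" using m by (simp add: is_monomial_valuation_def ratfuns_UNIV)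
    have "W (indet - const c) = lex_embed (wb (indet - const c))" if c: "c \<in> alg_cl K" for c
    proof -
      have "W (indet - const c) = min (V (a - c)) (Fin (0, \<gamma>))"
        by (rule monomial_linear[OF m subfield_UNIV UNIV_I V.one])
      also have "\<dots> = lex_embed (min (vhb (a - c)) (Fin \<gamma>))" by (simp add: V_def lex_embed_min)
      also have "vhb (a - c) = wb (const (a - c))" using subfield_diff[OF E a c] by (simp only: wb_const)
      also have "min (wb (const (a - c))) (Fin \<gamma>) = wb (indet - const c)"
        by (rule monomial_linear[OF mb E c, symmetric]) (simp add: wb.one)
      finally show ?thesis .
    qed
    then show ?thesis
      using True reduce[OF Wv monomial_const[OF m]] Wv monomial_const[OF m] a m by auto
  next
    case False
    then obtain r :: "'g rel" and g z where r: "limit_order r"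
      and g: "strict_cofinal_seq r g {wb (indet - const c) | c. c \<in> alg_cl K}"
      and z: "\<And>\<nu>. \<nu> \<in> Field r \<Longrightarrow> z \<nu> \<in> alg_cl K \<and> wb (indet - const (z \<nu>)) = g \<nu>"
      and lim: "if \<exists>a. pCs_limit vhb r z a
              then \<exists>a. pCs_limit vhb r z a \<and> is_monomial_valuation UNIV V a (1, 0) W
              else valuation_on UNIV W \<and> (\<forall>c. W (const c) = V c) \<and> pCs_limit W r (\<lambda>\<nu>. const (z \<nu>)) indet"
      using W unfolding is_induced_extension_def V_def by auto
    interpret S: cofinal_approximation "alg_cl K" vhb wb r g z
      by (rule cofinal_approximation.intro) (fact E v wb wb_const r g z)+
    show ?thesis
    proof (cases "\<exists>a. pCs_limit vhb r z a")
      case True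
      then obtain a where a: "pCs_limit vhb r z a" and m: "is_monomial_valuation UNIV V a (1, 0) W"
        using lim by auto
      have Wv: "valuation_on UNIV W" using m by (simp add: is_monomial_valuation_def ratfuns_UNIV)
      have al: "V (a - z \<nu>) = lex_embed (g \<nu>)" if "\<nu> \<in> Field r" for \<nu>
        using a that S.diff_value_seq[OF that] by (simp add: V_def pCs_limit_def)
      have "W (indet - const c) = lex_embed (wb (indet - const c))" if c: "c \<in> alg_cl K" for c
      proof -
        have eq: "V (a - c) = lex_embed (wb (indet - const c))"
          using S.limit_linear_value[OF V.valued_axioms, of "\<lambda>c. c" a c] al c by (simp add: V_def)
        \<comment> \<open>Its image \<open>(0, x)\<close> lies below \<open>(1, 0)\<close>, so the
          minimum in \<open>monomial_linear\<close> is attained by \<open>V (a - c)\<close>.\<close>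
        obtain x where x: "wb (indet - const c) = Fin x"
          using wb.Fin[OF S.linear_closed[OF c]] indet_neq_const[of c] by (metis eq_iff_diff_eq_0)
        have "W (indet - const c) = min (V (a - c)) (Fin (1, 0))"
          by (rule monomial_linear[OF m subfield_UNIV UNIV_I V.one])
        then show ?thesis unfolding eq x by (simp add: min_def)
      qed
      then show ?thesis
        using False reduce[OF Wv monomial_const[OF m]] Wv monomial_const[OF m] m by auto
    next
      case no_limit: False
      then have Wv: "valuation_on UNIV W" and Wc: "\<And>c. W (const c) = V c"
        and Wl: "pCs_limit W r (\<lambda>\<nu>. const (z \<nu>)) indet"
        using lim by auto
      interpret W: valued UNIV W using Wv by (rule valued_UNIV)
      have Wz: "W (indet - const (z \<nu>)) = lex_embed (g \<nu>)" if "\<nu> \<in> Field r" for \<nu>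
        using Wl that S.diff_value_seq[OF that] Wc[of "z \<nu> - z (wo_rel.suc r {\<nu>})"]
        by (simp add: V_def pCs_limit_def)
      have "W (indet - const c) = lex_embed (wb (indet - const c))" if c: "c \<in> alg_cl K" for c
        using S.limit_linear_value[OF W.valued_axioms, of const indet c] Wc Wz c by (simp add: V_def)
      moreover have "\<exists>y. W (indet - const c) < W (indet - const y)" for c
      proof -
        \<comment> \<open>\<open>c\<close> is not a limit. If \<open>c\<close> is farther from
          \<open>z \<nu>\<close> than \<open>X\<close> is, then \<open>z \<nu>\<close> is a better
          approximation of \<open>X\<close> than \<open>c\<close>; if it is closer, then
          \<open>X - c\<close> has value \<open>g \<nu>\<close>, and the next member of the sequence
          is better.\<close>
        obtain \<nu> where \<nu>: "\<nu> \<in> Field r" "vhb (c - z \<nu>) \<noteq> g \<nu>"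
          using no_limit S.diff_value_seq unfolding pCs_limit_def by metis
        have zc: "W (const (z \<nu> - c)) = lex_embed (vhb (c - z \<nu>))"
          using Wc[of "z \<nu> - c"] v.minus_commute[of c "z \<nu>"] by (simp add: V_def)
        have sum: "indet - const c = (indet - const (z \<nu>)) + const (z \<nu> - c)" by simp
        show ?thesis
        proof (cases "vhb (c - z \<nu>) < g \<nu>")
          case True
          then have "W (const (z \<nu> - c) + (indet - const (z \<nu>))) = lex_embed (vhb (c - z \<nu>))"
            using W.add_eq[of "const (z \<nu> - c)" "indet - const (z \<nu>)"] zc Wz[OF \<nu>(1)] by simp
          then have "W (indet - const c) < W (indet - const (z \<nu>))"
            unfolding sum using True Wz[OF \<nu>(1)] by (simp add: add.commute)
          then show ?thesis by blast
        next
          case False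
          then have "g \<nu> < vhb (c - z \<nu>)" using \<nu>(2) by simp
          then have "W (indet - const c) = lex_embed (g \<nu>)"
            unfolding sum using W.add_eq[of "indet - const (z \<nu>)" "const (z \<nu> - c)"] zc Wz[OF \<nu>(1)] by simp
          also have "\<dots> < W (indet - const (z (wo_rel.suc r {\<nu>})))"
            using Wz[OF limit_order_suc(1)[OF r \<nu>(1)]] S.step[OF \<nu>(1)] by simp
          finally show ?thesis by blast
        qed
      qed
      ultimately show ?thesis using False reduce[OF Wv Wc] Wv Wc by auto
    qed
  qed
qed

theorem theorem1p2:
  fixes K Kh :: "'a::alg_closed_field set"
    and v vh vhb :: "'a \<Rightarrow> 'g::linordered_ab_group_add extended"
    and w wb wb1 :: "'a poly fract \<Rightarrow> 'g extended"
    and W W1 :: "'a poly fract \<Rightarrow> (int \<times> 'g) extended"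
  assumes "subfield K ambient" and "valuation_on K v"
    and "is_completion K v Kh vh"
    and "alg_cl Kh = UNIV"
    and "valuation_on UNIV vhb" and "\<forall>x\<in>Kh. vhb x = vh x"
    and "valuation_on (ratfuns K) w" and "\<forall>c\<in>K. w (const c) = v c"
    and "valuation_on (ratfuns (alg_cl K)) wb"
    and "\<forall>x\<in>ratfuns K. wb x = w x" and "\<forall>c\<in>alg_cl K. wb (const c) = vhb c"
    and "valuation_on (ratfuns (alg_cl K)) wb1"
    and "\<forall>x\<in>ratfuns K. wb1 x = w x" and "\<forall>c\<in>alg_cl K. wb1 (const c) = vhb c"
    and "is_induced_extension K vhb wb W"
    and "is_induced_extension K vhb wb1 W1"
  shows "(valuation_algebraic Kh W \<longleftrightarrow> valuation_algebraic Kh W1) \<and>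
    (valuation_transcendental Kh W \<longleftrightarrow> valuation_transcendental Kh W1) \<and>
    (valuation_transcendental Kh W \<and> valuation_transcendental Kh W1 \<longrightarrow>
       (\<exists>a a1 \<gamma>. minimal_pair_of_definition Kh W a \<gamma> \<and>
                 minimal_pair_of_definition Kh W1 a1 \<gamma> \<and>
                 conjugate_over Kh a a1) \<and>
       (\<forall>a a1 \<gamma>. minimal_pair_of_definition Kh W a \<gamma> \<and>
                 minimal_pair_of_definition Kh W1 a1 \<gamma> \<and>
                 conjugate_over Kh a a1 \<and> a \<in> alg_cl K \<and> a1 \<in> alg_cl K \<longrightarrow>
                 conjugate_over K a a1))"
proof -
  note K = assms(1)
  define V where "V c = lex_embed (vhb c)" for c
  have comp: "subfield Kh ambient" "K \<subseteq> Kh" "valuation_on Kh vh" "dense_in K Kh vh"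
    using assms(3) by (simp_all add: is_completion_def)
  interpret vhb: valued UNIV vhb using assms(5) by (rule valued_UNIV)
  have Vval: "valued UNIV V" unfolding V_def by (rule valued_lex_embed[OF vhb.valued_axioms])
  have dense: "dense_in K Kh V"
    unfolding dense_in_def
  proof (intro ballI)
    fix a \<gamma> assume a: "a \<in> Kh" and "\<gamma> \<in> value_group V Kh"
    then obtain x where x: "x \<in> Kh" "V x = Fin \<gamma>" by (auto simp: value_group_def)
    then obtain \<alpha> where \<alpha>: "vhb x = Fin \<alpha>" by (cases "vhb x") (auto simp: V_def)
    then have "\<alpha> \<in> value_group vh Kh" using x(1) assms(6) by (auto simp: value_group_def)
    then obtain b where b: "b \<in> K" "Fin \<alpha> < vh (a - b)" using comp(4) a by (auto simp: dense_in_def)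
    then have "Fin \<alpha> < vhb (a - b)"
      using assms(6) comp(2) subfield_diff[OF comp(1) a] by auto
    then have "V x < V (a - b)" by (simp only: V_def \<alpha> lex_embed_simps)
    then show "\<exists>b\<in>K. Fin \<gamma> < V (a - b)" using b(1) x(2) by auto
  qed
  note C = induced_extension_cases[OF K assms(5) assms(9) _ assms(15), folded V_def]
  note C1 = induced_extension_cases[OF K assms(5) assms(12) _ assms(16), folded V_def]
  have cs: "valuation_on UNIV W" "\<And>c. W (const c) = V c"
    "\<And>p. p \<in> polys_over K \<Longrightarrow> W (to_fract p) = lex_embed (wb (to_fract p))"
    "if valuation_transcendental K wb then \<exists>a\<in>alg_cl K. \<exists>\<gamma>. is_monomial_valuation UNIV V a (0, \<gamma>) W
     else (\<exists>a. is_monomial_valuation UNIV V a (1, 0) W) \<or> (\<forall>c. \<exists>z. W (indet - const c) < W (indet - const z))"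
    using C assms(11) by simp_all
  have cs1: "valuation_on UNIV W1" "\<And>c. W1 (const c) = V c"
    "\<And>p. p \<in> polys_over K \<Longrightarrow> W1 (to_fract p) = lex_embed (wb1 (to_fract p))"
    "if valuation_transcendental K wb1 then \<exists>a\<in>alg_cl K. \<exists>\<gamma>. is_monomial_valuation UNIV V a (0, \<gamma>) W1
     else (\<exists>a. is_monomial_valuation UNIV V a (1, 0) W1) \<or> (\<forall>c. \<exists>z. W1 (indet - const c) < W1 (indet - const z))"
    using C1 assms(14) by simp_all
  have wb_wb1: "wb x = wb1 x" if "x \<in> ratfuns K" for x using assms(10,13) that by simp
  have same: "valuation_transcendental K wb \<longleftrightarrow> valuation_transcendental K wb1"
    by (rule valuation_transcendental_cong[OF wb_wb1])
  have W_W1: "W (to_fract p) = W1 (to_fract p)" if "p \<in> polys_over K" for p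
    using cs(3)[OF that] cs1(3)[OF that] wb_wb1[OF to_fract_ratfuns[OF that]] by simp
  interpret D: dense_ext2 V K Kh W W1
    by (intro dense_ext2.intro dense_ext.intro dense_subfield.intro dense_subfield_axioms.intro
        ext_valued.intro ext_valued_axioms.intro dense_ext2_axioms.intro valued_UNIV)
       (use Vval K comp dense assms(4) cs(1,2) cs1(1,2) W_W1 in \<open>simp_all add: valued_def\<close>)
  interpret S: dense_ext2 V K Kh W1 W by (rule D.swap)
  have monomial: "(valuation_transcendental Kh W \<longleftrightarrow> valuation_transcendental Kh W1) \<and>
      (\<exists>a a1 \<gamma>. minimal_pair_of_definition Kh W a \<gamma> \<and> minimal_pair_of_definition Kh W1 a1 \<gamma> \<and>
        conjugate_over Kh a a1)"
    if m: "is_monomial_valuation UNIV V a \<gamma> W" "is_monomial_valuation UNIV V a1 \<gamma> W1" for a a1 \<gamma>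
  proof
    have eq: "W (to_fract p) = W1 (to_fract p)" if "p \<in> polys_over Kh" for p
      by (rule D.eq_Kh[OF m that])
    show "valuation_transcendental Kh W \<longleftrightarrow> valuation_transcendental Kh W1"
      by (rule valuation_transcendental_cong, rule D.eq_ratfuns[OF eq])
    show "\<exists>a a1 \<gamma>. minimal_pair_of_definition Kh W a \<gamma> \<and> minimal_pair_of_definition Kh W1 a1 \<gamma> \<and>
        conjugate_over Kh a a1"
      using D.conjugate_minimal_pairs[OF m eq] by blast
  qed
  \<comment> \<open>Values of constants have first component 0.\<close>
  have infinite: "\<beta> < (1, 0)" if \<beta>: "\<beta> \<in> value_group V K" for \<beta>
  proof -
    obtain x where "lex_embed (vhb x) = Fin \<beta>" using \<beta> by (auto simp: value_group_def V_def)
    then show ?thesis by (cases "vhb x") auto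
  qed
  have "(valuation_transcendental Kh W \<longleftrightarrow> valuation_transcendental Kh W1) \<and>
      (valuation_transcendental Kh W \<longrightarrow>
        (\<exists>a a1 \<gamma>. minimal_pair_of_definition Kh W a \<gamma> \<and> minimal_pair_of_definition Kh W1 a1 \<gamma> \<and>
          conjugate_over Kh a a1))"
  proof (cases "valuation_transcendental K wb")
    case True
    then obtain a \<gamma> a1 \<gamma>1 where a: "a \<in> alg_cl K" and m: "is_monomial_valuation UNIV V a (0, \<gamma>) W"
      and a1: "a1 \<in> alg_cl K" and m1: "is_monomial_valuation UNIV V a1 (0, \<gamma>1) W1"
      using cs(4) cs1(4) same by auto
    \<comment> \<open>The two pairs of definition were chosen independently; comparing slopes in
      both directions shows that they share \<open>\<gamma>\<close>.\<close>
    have "(0::int, \<gamma>) = (0, \<gamma>1)"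
      by (rule antisym[OF D.slope_le[OF m m1 a] S.slope_le[OF m1 m a1]])
    then show ?thesis using monomial[OF m] m1 by blast
  next
    case False
    \<comment> \<open>If just one sequence has a limit, the agreement over \<open>K\<close> is
      contradicted; if neither has, both induced extensions are valuation algebraic and the claim
      about pairs is vacuous.\<close>
    then consider (limits) a a1 where "is_monomial_valuation UNIV V a (1, 0) W" "is_monomial_valuation UNIV V a1 (1, 0) W1"
      | (left) a where "is_monomial_valuation UNIV V a (1, 0) W" "\<And>c. \<exists>z. W1 (indet - const c) < W1 (indet - const z)"
      | (right) a1 where "is_monomial_valuation UNIV V a1 (1, 0) W1" "\<And>c. \<exists>z. W (indet - const c) < W (indet - const z)"
      | (no_limits) "\<And>c. \<exists>z. W (indet - const c) < W (indet - const z)" "\<And>c. \<exists>z. W1 (indet - const c) < W1 (indet - const z)"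
      using cs(4) cs1(4) same by auto
    then show ?thesis
    proof cases
      case limits
      then show ?thesis using monomial by blast
    next
      case left
      then show ?thesis using D.infinite_slope_not_immediate[OF left(1) infinite left(2)] by blast
    next
      case right
      then show ?thesis using S.infinite_slope_not_immediate[OF right(1) infinite right(2)] by blast
    next
      case no_limits
      then show ?thesis
        using D.not_value_transcendental D.not_residue_transcendental
          D.W1.not_value_transcendental D.W1.not_residue_transcendental
        unfolding valuation_transcendental_def by blast
    qed
  qed
  then show ?thesis
    unfolding valuation_algebraic_def using conjugate_over_mono[OF K comp(1,2)] by blast
qed

end
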